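(* Let $\Omega\subset\mathbb{C}^d$ be a hyperbolic domain (not necessarily bounded) and let $\Omega_0\subset\mathbb{C}^d$ be a visibility domain. If there exists a biholomorphism $\Phi:\Omega_0\to\Omega$ that extends to a continuous surjective map from $\overline{\Omega_0}^{End}$ to $\overline{\Omega}^{End}$, then $\Omega$ is a visibility domain.
   Context: For a domain $\Omega\subset\mathbb{C}^d$, $\mathsf{k}_\Omega$ is the Kobayashi (pseudo)distance and $\kappa_\Omega(z;v)$ the Kobayashi--Royden (pseudo)metric; $\Omega$ is hyperbolic if $\mathsf{k}_\Omega$ is a distance. Almost-geodesics: for $\lambda\ge1,\kappa\ge0$ and an interval $I\subset\mathbb{R}$, a map $\sigma:I\to\Omega$ is a $(\lambda,\kappa)$-almost-geodesic (for $\mathsf{k}_\Omega$) if (i) $\frac1\lambda|s-t|-\kappa\le \mathsf{k}_\Omega(\sigma(s),\sigma(t))\le\lambda|s-t|+\kappa$ for all $s,t\in I$; (ii) $\sigma$ is absolutely continuous and $\kappa_\Omega(\sigma(t);\sigma'(t))\le\lambda$ for a.e. $t\in I$. End compactification: if $\Omega$ is bounded, $\overline{\Omega}^{End}:=\overline{\Omega}$. If $\Omega$ is unbounded, fix an exhaustion $(K_j)_{j\ge1}$ of $\overline\Omega$ by compact sets with $K_j$ contained in the interior (in $\overline\Omega$) of $K_{j+1}$. An end of $\overline\Omega$ is a sequence $(F_j)_{j\ge1}$ with $F_j$ a connected component of $\overline\Omega\setminus K_j$ and $F_{j+1}\subset F_j$. As a set, $\overline{\Omega}^{End}$ is $\overline\Omega$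 together with all ends. Points of $\overline\Omega$ have their Euclidean neighbourhoods in $\overline\Omega$ as neighbourhood basis; an end $(F_j)_j$ has the neighbourhood basis $(\widehat F_j)_j$, where $\widehat F_j$ is $F_j$ together with all ends $(G_\nu)_\nu$ with $G_\nu=F_\nu$ for $\nu=1,\dots,j$. (Up to natural homeomorphism this does not depend on the exhaustion.) $\partial\overline{\Omega}^{End}:=\overline{\Omega}^{End}\setminus\Omega$. Visibility: distinct $\zeta,\eta\in\partial\overline{\Omega}^{End}$ satisfy the $(\lambda,\kappa)$-visibility property with respect to $\mathsf{k}_\Omega$ if there exist neighbourhoods $V_\zeta$, $V_\eta$ of $\zeta,\eta$ in $\overline{\Omega}^{End}$ with $\overline{V_\zeta}\cap\overline{V_\eta}=\emptyset$ and a compact $K\subset\Omega$ such that every $(\lambda,\kappa)$-almost-geodesic $\sigma:[0,T]\to\Omega$ for $\mathsf{k}_\Omega$ with $\sigma(0)\in V_\zeta$, $\sigma(T)\in V_\eta$ satisfies $\sigma([0,T])\cap K\ne\emptyset$. A hyperbolic domain $\Omega$ is a visibility domain if for all $\lambda\ge1$ and $\kappa>0$ every pair of distinct points of $\partial\overline{\Omega}^{End}$ satisfies the $(\lambda,\kappa)$-visibility property. *)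

theory Defs
  imports "HOL-Analysis.Analysis"
begin

section \<open>Domains and holomorphic maps in $\mathbf{C}^d$\<close>

definition domain :: "(complex ^ 'd) set \<Rightarrow> bool" where
  "domain \<Omega> \<longleftrightarrow> open \<Omega> \<and> connected \<Omega> \<and> \<Omega> \<noteq> {}"

definition holomorphic_map_on ::
    "(complex ^ 'd) set \<Rightarrow> (complex ^ 'd \<Rightarrow> complex ^ 'd) \<Rightarrow> bool" where
  "holomorphic_map_on \<Omega> \<Phi> \<longleftrightarrow>
     (\<forall>z\<in>\<Omega>. \<exists>D. (\<Phi> has_derivative D) (at z) \<and> (\<forall>c v. D (c *s v) = c *s D v))"

definition biholomorphism ::
    "(complex ^ 'd) set \<Rightarrow> (complex ^ 'd) set \<Rightarrow> (complex ^ 'd \<Rightarrow> complex ^ 'd) \<Rightarrow> bool" where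
  "biholomorphism \<Omega>\<^sub>0 \<Omega> \<Phi> \<longleftrightarrow>
     bij_betw \<Phi> \<Omega>\<^sub>0 \<Omega> \<and> holomorphic_map_on \<Omega>\<^sub>0 \<Phi> \<and> holomorphic_map_on \<Omega> (the_inv_into \<Omega>\<^sub>0 \<Phi>)"

text \<open>Holomorphic maps from the unit disc into \<open>\<Omega>\<close>.\<close>

definition analytic_disc :: "(complex ^ 'd) set \<Rightarrow> (complex \<Rightarrow> complex ^ 'd) \<Rightarrow> bool" where
  "analytic_disc \<Omega> f \<longleftrightarrow>
     (\<forall>i. (\<lambda>\<zeta>. f \<zeta> $ i) holomorphic_on ball 0 1) \<and> f ` ball 0 1 \<subseteq> \<Omega>"


section \<open>The Kobayashi distance and the Kobayashi--Royden metric\<close>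

text \<open>
  The Poincare distance is normalised so that its infinitesimal form is
  $|d\zeta| / (1 - |\zeta|^2)$. This matches the Kobayashi--Royden metric below, of which the
  Kobayashi distance is the integrated form.
\<close>

definition poincare_dist :: "complex \<Rightarrow> complex \<Rightarrow> real" where
  "poincare_dist a b = artanh (cmod ((a - b) / (1 - cnj b * a)))"

text \<open>
  The infimum is over all chains of analytic discs \<open>f 0, \<dots>, f (n - 1)\<close> joining \<open>z\<close> to \<open>w\<close>
  through the points \<open>p 0, \<dots>, p n\<close>. It is only meaningful for \<open>z\<close>, \<open>w\<close> in the domain \<open>\<Omega>\<close>,
  where such chains exist.
\<close>

definition kobayashi_dist ::
    "(complex ^ 'd) set \<Rightarrow> complex ^ 'd \<Rightarrow> complex ^ 'd \<Rightarrow> real" where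
  "kobayashi_dist \<Omega> z w = Inf {(\<Sum>j<n. poincare_dist (a j) (b j)) | n a b f p.
     p 0 = z \<and> p n = w \<and>
     (\<forall>j<n. analytic_disc \<Omega> (f j) \<and> a j \<in> ball 0 1 \<and> b j \<in> ball 0 1 \<and>
            f j (a j) = p j \<and> f j (b j) = p (Suc j))}"

definition kobayashi_royden ::
    "(complex ^ 'd) set \<Rightarrow> complex ^ 'd \<Rightarrow> complex ^ 'd \<Rightarrow> real" where
  "kobayashi_royden \<Omega> z v = Inf {cmod c | c f.
     analytic_disc \<Omega> f \<and> f 0 = z \<and> c *s (\<chi> i. deriv (\<lambda>\<zeta>. f \<zeta> $ i) 0) = v}"

text \<open>
  The locale \<open>Metric_space\<close> demands symmetry and non-negativity on the whole type, so the
  distance is set to 0 off \<open>\<Omega>\<close>.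
\<close>

definition hyperbolic :: "(complex ^ 'd) set \<Rightarrow> bool" where
  "hyperbolic \<Omega> \<longleftrightarrow>
     Metric_space \<Omega> (\<lambda>z w. if z \<in> \<Omega> \<and> w \<in> \<Omega> then kobayashi_dist \<Omega> z w else 0)"


section \<open>Almost-geodesics\<close>

definition abs_continuous_on :: "real set \<Rightarrow> (real \<Rightarrow> 'a::real_normed_vector) \<Rightarrow> bool" where
  "abs_continuous_on I \<sigma> \<longleftrightarrow>
     (\<forall>\<epsilon>>0. \<exists>\<delta>>0. \<forall>(n::nat) a b.
        (\<forall>i<n. a i \<le> b i \<and> {a i..b i} \<subseteq> I) \<and>
        (\<forall>i<n. \<forall>j<n. i \<noteq> j \<longrightarrow> {a i<..<b i} \<inter> {a j<..<b j} = {}) \<and>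
        (\<Sum>i<n. b i - a i) < \<delta>
        \<longrightarrow> (\<Sum>i<n. norm (\<sigma> (b i) - \<sigma> (a i))) < \<epsilon>)"

definition almost_geodesic ::
    "(complex ^ 'd) set \<Rightarrow> real \<Rightarrow> real \<Rightarrow> real set \<Rightarrow> (real \<Rightarrow> complex ^ 'd) \<Rightarrow> bool" where
  "almost_geodesic \<Omega> l k I \<sigma> \<longleftrightarrow>
     \<sigma> ` I \<subseteq> \<Omega> \<and>
     (\<forall>s\<in>I. \<forall>t\<in>I. 1 / l * \<bar>s - t\<bar> - k \<le> kobayashi_dist \<Omega> (\<sigma> s) (\<sigma> t) \<and>
                    kobayashi_dist \<Omega> (\<sigma> s) (\<sigma> t) \<le> l * \<bar>s - t\<bar> + k) \<and>
     abs_continuous_on I \<sigma> \<and>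
     (AE t in lebesgue. t \<in> I \<longrightarrow>
        (\<exists>v. (\<sigma> has_vector_derivative v) (at t within I) \<and> kobayashi_royden \<Omega> (\<sigma> t) v \<le> l))"


section \<open>The end compactification\<close>

definition compact_exhaustion :: "'a::topological_space set \<Rightarrow> (nat \<Rightarrow> 'a set) \<Rightarrow> bool" where
  "compact_exhaustion S K \<longleftrightarrow>
     (\<forall>j. compact (K j) \<and> K j \<subseteq> S \<and> K j \<subseteq> top_of_set S interior_of K (Suc j)) \<and>
     (\<Union>j. K j) = S"

definition ends_of :: "'a::topological_space set \<Rightarrow> (nat \<Rightarrow> 'a set) \<Rightarrow> (nat \<Rightarrow> 'a set) set" where
  "ends_of S K = {F. \<forall>j. F j \<in> components (S - K j) \<and> F (Suc j) \<subseteq> F j}"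

datatype 'a end_point = Pt 'a | End "nat \<Rightarrow> 'a set"

text \<open>
  In the following, \<open>K\<close> is the exhaustion of \<open>closure \<Omega>\<close> fixed to define the ends; it plays no
  role if \<open>\<Omega>\<close> is bounded.
\<close>

definition end_carrier ::
    "(nat \<Rightarrow> 'a set) \<Rightarrow> 'a::metric_space set \<Rightarrow> 'a end_point set" where
  "end_carrier K \<Omega> =
     Pt ` closure \<Omega> \<union> (if bounded \<Omega> then {} else End ` ends_of (closure \<Omega>) K)"

definition end_nbhd ::
    "(nat \<Rightarrow> 'a set) \<Rightarrow> 'a::metric_space set \<Rightarrow> (nat \<Rightarrow> 'a set) \<Rightarrow> nat \<Rightarrow> 'a end_point set" where
  "end_nbhd K \<Omega> F j =
     Pt ` F j \<union> End ` {G \<in> ends_of (closure \<Omega>) K. \<forall>i\<le>j. G i = F i}"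

text \<open>
  A set is open iff together with each of its points it contains a member of the prescribed
  neighbourhood basis of that point.
\<close>

definition end_compactification ::
    "(nat \<Rightarrow> 'a set) \<Rightarrow> 'a::metric_space set \<Rightarrow> 'a end_point topology" where
  "end_compactification K \<Omega> = topology (\<lambda>U.
     U \<subseteq> end_carrier K \<Omega> \<and>
     (\<forall>x. Pt x \<in> U \<longrightarrow> (\<exists>e>0. Pt ` (ball x e \<inter> closure \<Omega>) \<subseteq> U)) \<and>
     (\<forall>F. End F \<in> U \<longrightarrow> (\<exists>j. end_nbhd K \<Omega> F j \<subseteq> U)))"

lemma end_nbhd_antimono:
  assumes "F \<in> ends_of (closure \<Omega>) K" "i \<le> j"
  shows "end_nbhd K \<Omega> F j \<subseteq> end_nbhd K \<Omega> F i"
proof -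
  have "F (Suc n) \<subseteq> F n" for n
    using assms(1) by (simp add: ends_of_def)
  then have "F j \<subseteq> F i"
    using assms(2) by (rule lift_Suc_antimono_le)
  then show ?thesis
    using assms(2) by (auto simp: end_nbhd_def)
qed

lemma openin_end_compactification:
  "openin (end_compactification K \<Omega>) U \<longleftrightarrow>
     U \<subseteq> end_carrier K \<Omega> \<and>
     (\<forall>x. Pt x \<in> U \<longrightarrow> (\<exists>e>0. Pt ` (ball x e \<inter> closure \<Omega>) \<subseteq> U)) \<and>
     (\<forall>F. End F \<in> U \<longrightarrow> (\<exists>j. end_nbhd K \<Omega> F j \<subseteq> U))"
proof -
  define P where "P U \<longleftrightarrow> U \<subseteq> end_carrier K \<Omega> \<and>
     (\<forall>x. Pt x \<in> U \<longrightarrow> (\<exists>e>0. Pt ` (ball x e \<inter> closure \<Omega>) \<subseteq> U)) \<and>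
     (\<forall>F. End F \<in> U \<longrightarrow> (\<exists>j. end_nbhd K \<Omega> F j \<subseteq> U))" for U
  have P_Pt: "\<exists>e>0. Pt ` (ball x e \<inter> closure \<Omega>) \<subseteq> S" if "P S" "Pt x \<in> S" for S x
    using that by (simp add: P_def)
  have P_End: "\<exists>j. end_nbhd K \<Omega> F j \<subseteq> S" if "P S" "End F \<in> S" for S F
    using that by (simp add: P_def)
  have P_carrier: "S \<subseteq> end_carrier K \<Omega>" if "P S" for S
    using that by (simp add: P_def)
  have "P (S \<inter> T)" if S: "P S" and T: "P T" for S T
    unfolding P_def
  proof (intro conjI allI impI)
    show "S \<inter> T \<subseteq> end_carrier K \<Omega>"
      using P_carrier[OF S] by blast
  next
    fix x assume x: "Pt x \<in> S \<inter> T"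
    obtain d where d: "d > 0" "Pt ` (ball x d \<inter> closure \<Omega>) \<subseteq> S"
      using P_Pt[OF S] x by blast
    obtain e where e: "e > 0" "Pt ` (ball x e \<inter> closure \<Omega>) \<subseteq> T"
      using P_Pt[OF T] x by blast
    have "ball x (min d e) \<subseteq> ball x d" "ball x (min d e) \<subseteq> ball x e"
      by (simp_all add: subset_ball)
    then have "Pt ` (ball x (min d e) \<inter> closure \<Omega>) \<subseteq> S \<inter> T"
      using d(2) e(2) by blast
    then show "\<exists>e>0. Pt ` (ball x e \<inter> closure \<Omega>) \<subseteq> S \<inter> T"
      using d(1) e(1) by (intro exI[of _ "min d e"]) simp
  next
    fix F assume F: "End F \<in> S \<inter> T"
    then have "End F \<in> end_carrier K \<Omega>"
      using P_carrier[OF S] by blast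
    then have F_end: "F \<in> ends_of (closure \<Omega>) K"
      by (auto simp: end_carrier_def split: if_splits)
    obtain i where i: "end_nbhd K \<Omega> F i \<subseteq> S"
      using P_End[OF S] F by blast
    obtain j where j: "end_nbhd K \<Omega> F j \<subseteq> T"
      using P_End[OF T] F by blast
    have "end_nbhd K \<Omega> F (max i j) \<subseteq> S"
      using end_nbhd_antimono[OF F_end max.cobounded1] i by (rule subset_trans)
    moreover have "end_nbhd K \<Omega> F (max i j) \<subseteq> T"
      using end_nbhd_antimono[OF F_end max.cobounded2] j by (rule subset_trans)
    ultimately have "end_nbhd K \<Omega> F (max i j) \<subseteq> S \<inter> T" by (rule Int_greatest)
    then show "\<exists>j. end_nbhd K \<Omega> F j \<subseteq> S \<inter> T" by blast
  qed
  moreover have "P (\<Union>\<U>)" if \<U>: "\<forall>S\<in>\<U>. P S" for \<U>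
    unfolding P_def
  proof (intro conjI allI impI)
    show "\<Union>\<U> \<subseteq> end_carrier K \<Omega>"
      using \<U> P_carrier by blast
  next
    fix x assume "Pt x \<in> \<Union>\<U>"
    then obtain S where S: "S \<in> \<U>" "Pt x \<in> S" by blast
    then obtain e where "e > 0" "Pt ` (ball x e \<inter> closure \<Omega>) \<subseteq> S"
      using P_Pt[of S x] \<U> by blast
    then show "\<exists>e>0. Pt ` (ball x e \<inter> closure \<Omega>) \<subseteq> \<Union>\<U>"
      using S(1) by blast
  next
    fix F assume "End F \<in> \<Union>\<U>"
    then obtain S where S: "S \<in> \<U>" "End F \<in> S" by blast
    then obtain j where "end_nbhd K \<Omega> F j \<subseteq> S"
      using P_End[of S F] \<U> by blast
    then show "\<exists>j. end_nbhd K \<Omega> F j \<subseteq> \<Union>\<U>"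
      using S(1) by blast
  qed
  ultimately have "istopology P"
    unfolding istopology_def by blast
  then have "openin (topology P) U = P U"
    by (simp add: topology_inverse')
  then show ?thesis
    unfolding end_compactification_def P_def[abs_def] .
qed

lemma topspace_end_compactification [simp]:
  "topspace (end_compactification K \<Omega>) = end_carrier K \<Omega>"
proof
  show "topspace (end_compactification K \<Omega>) \<subseteq> end_carrier K \<Omega>"
    using openin_end_compactification[of K \<Omega> "topspace (end_compactification K \<Omega>)"] by simp
  have F0: "F 0 \<subseteq> closure \<Omega>" if "F \<in> ends_of (closure \<Omega>) K" for F
  proof -
    have "F 0 \<in> components (closure \<Omega> - K 0)"
      using that by (simp add: ends_of_def)
    then show ?thesis
      using in_components_subset by fastforce
  qed
  have "openin (end_compactification K \<Omega>) (end_carrier K \<Omega>)"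
    unfolding openin_end_compactification
  proof (intro conjI allI impI)
    show "\<exists>e>0. Pt ` (ball x e \<inter> closure \<Omega>) \<subseteq> end_carrier K \<Omega>" for x
      by (rule exI[of _ 1]) (auto simp: end_carrier_def)
    show "\<exists>j. end_nbhd K \<Omega> F j \<subseteq> end_carrier K \<Omega>" if "End F \<in> end_carrier K \<Omega>" for F
    proof
      have "F \<in> ends_of (closure \<Omega>) K" "\<not> bounded \<Omega>"
        using that by (auto simp: end_carrier_def split: if_splits)
      then show "end_nbhd K \<Omega> F 0 \<subseteq> end_carrier K \<Omega>"
        using F0 by (auto simp: end_carrier_def end_nbhd_def)
    qed
  qed simp
  then show "end_carrier K \<Omega> \<subseteq> topspace (end_compactification K \<Omega>)"
    by (rule openin_subset)
qed

definition end_boundary ::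
    "(nat \<Rightarrow> 'a set) \<Rightarrow> 'a::metric_space set \<Rightarrow> 'a end_point set" where
  "end_boundary K \<Omega> = end_carrier K \<Omega> - Pt ` \<Omega>"


section \<open>Visibility\<close>

definition visibility_property ::
    "(nat \<Rightarrow> (complex ^ 'd) set) \<Rightarrow> (complex ^ 'd) set \<Rightarrow> real \<Rightarrow> real \<Rightarrow>
     (complex ^ 'd) end_point \<Rightarrow> (complex ^ 'd) end_point \<Rightarrow> bool" where
  "visibility_property K \<Omega> l k \<zeta> \<eta> \<longleftrightarrow>
     (\<exists>V W C.
        openin (end_compactification K \<Omega>) V \<and> \<zeta> \<in> V \<and>
        openin (end_compactification K \<Omega>) W \<and> \<eta> \<in> W \<and>
        end_compactification K \<Omega> closure_of V \<inter> end_compactification K \<Omega> closure_of W = {} \<and>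
        compact C \<and> C \<subseteq> \<Omega> \<and>
        (\<forall>T \<sigma>. 0 \<le> T \<and> almost_geodesic \<Omega> l k {0..T} \<sigma> \<and> Pt (\<sigma> 0) \<in> V \<and> Pt (\<sigma> T) \<in> W
           \<longrightarrow> \<sigma> ` {0..T} \<inter> C \<noteq> {}))"

definition visibility_domain ::
    "(nat \<Rightarrow> (complex ^ 'd) set) \<Rightarrow> (complex ^ 'd) set \<Rightarrow> bool" where
  "visibility_domain K \<Omega> \<longleftrightarrow>
     domain \<Omega> \<and> hyperbolic \<Omega> \<and>
     (\<forall>l k. l \<ge> 1 \<and> k > 0 \<longrightarrow>
        (\<forall>\<zeta>\<in>end_boundary K \<Omega>. \<forall>\<eta>\<in>end_boundary K \<Omega>.
           \<zeta> \<noteq> \<eta> \<longrightarrow> visibility_property K \<Omega> l k \<zeta> \<eta>))"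

end

(*
  Visibility of Omega_0 makes its end compactification X_0 compact: otherwise infinitely many
  components of Omega_0 - K_j would reach far out, and almost-geodesics crossing a shell inside them
  would contradict visibility of a pair of limit points. Hence Psi : X_0 -> X is a closed map onto a
  compact Hausdorff space. The fibres of Psi over two distinct boundary points zeta, eta are disjoint
  compact subsets of the boundary of X_0; covering them by finitely many of the neighbourhoods
  given by visibility yields neighbourhoods of the whole fibres and one compact set that every
  almost-geodesic between them meets. As Psi is closed, these contain the preimages of
  neighbourhoods of zeta and eta, and biholomorphisms preserve almost-geodesics.
*)

theory Submission
  imports Defs "HOL-Complex_Analysis.Complex_Analysis"
begin

text \<open>Compactness has to be earned: without it a neighbourhood of a fibre need not contain the
  preimage of any neighbourhood of its base point, and the fibres themselves need not be compact.
  The curves behind it have to be built as well, since a distance defined by chains of discs comes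
  with no geodesics. The real diameters of the discs of a nearly optimal chain, run at unit Poincare
  speed, concatenate to a curve that takes at most slightly more time than the distance of its end
  points; the triangle inequality makes every subcurve equally efficient. Thus visibility is used
  with parameters (1,1) for compactness and with arbitrary (l,k) for the transfer. The crossing
  argument runs in the open set Omega_0 - K_j, whereas ends live in the closure, so finiteness has
  to be carried over. Holomorphic maps are given by pointwise complex derivatives only; the local
  Lipschitz bound that preserves absolute continuity comes from Cauchy's inequality.\<close>

section \<open>Neighbourhoods and separation in the end compactification\<close>

lemma end_carrierD:
  assumes "End F \<in> end_carrier K \<Omega>"
  shows "F \<in> ends_of (closure \<Omega>) K" "\<not> bounded \<Omega>"
  using assms by (auto simp: end_carrier_def split: if_splits)

lemma end_carrier_Pt [simp]: "Pt x \<in> end_carrier K \<Omega> \<longleftrightarrow> x \<in> closure \<Omega>"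
  by (auto simp: end_carrier_def)

text \<open>Trades the relative interior for a genuine open set, which can serve as the Euclidean
  part of a neighbourhood or as a thickening of \<open>K j\<close>.\<close>

lemma compact_exhaustion_interior:
  assumes "compact_exhaustion S K"
  obtains O' where "open O'" "K j \<subseteq> O'" "O' \<inter> S \<subseteq> K (Suc j)"
proof -
  have "K j \<subseteq> top_of_set S interior_of K (Suc j)"
    using assms by (auto simp: compact_exhaustion_def)
  moreover have "openin (top_of_set S) (top_of_set S interior_of K (Suc j))"
    by simp
  then obtain O' where O': "open O'" "top_of_set S interior_of K (Suc j) = S \<inter> O'"
    unfolding openin_open by blast
  moreover have "top_of_set S interior_of K (Suc j) \<subseteq> K (Suc j)"
    by (rule interior_of_subset)
  ultimately show thesis by (intro that[of O']) auto
qed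

lemma compact_exhaustion_props:
  assumes "compact_exhaustion S K"
  shows "compact (K j)" "K j \<subseteq> S" "K j \<subseteq> K (Suc j)" "(\<Union>j. K j) = S"
proof -
  show "compact (K j)" "K j \<subseteq> S" "(\<Union>j. K j) = S"
    using assms by (auto simp: compact_exhaustion_def)
  have "K j \<subseteq> top_of_set S interior_of K (Suc j)"
    using assms by (auto simp: compact_exhaustion_def)
  then show "K j \<subseteq> K (Suc j)"
    using interior_of_subset by (rule subset_trans)
qed

lemma obtain_component:
  assumes "x \<in> S"
  obtains E where "E \<in> components S" "x \<in> E"
  using assms Union_components[of S] by blast

lemma ends_of_antimono:
  assumes "F \<in> ends_of S K" "i \<le> j"
  shows "F j \<subseteq> F i"
proof -
  have "F (Suc n) \<subseteq> F n" for n
    using assms(1) by (simp add: ends_of_def)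
  then show ?thesis using assms(2) by (rule lift_Suc_antimono_le)
qed

text \<open>\<open>F j\<close> is nonempty and lies in both \<open>F i\<close> and
  \<open>G i\<close>, so these components coincide. Agreement at one level thus yields the agreement
  at all lower levels that \<open>end_nbhd\<close> asks for.\<close>

lemma ends_of_eq_below:
  assumes "F \<in> ends_of S K" "G \<in> ends_of S K" "F j = G j" "i \<le> j"
  shows "F i = G i"
proof -
  have comp: "F n \<in> components (S - K n)" "G n \<in> components (S - K n)" for n
    using assms by (auto simp: ends_of_def)
  have "F j \<noteq> {}" using comp in_components_nonempty by blast
  moreover have "F j \<subseteq> F i" "F j \<subseteq> G i"
    using assms ends_of_antimono by metis+
  ultimately have "F i \<inter> G i \<noteq> {}" by auto
  then show ?thesis using comp components_nonoverlap by blast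
qed

text \<open>
  The component \<open>F j\<close> need not be open in \<open>closure \<Omega>\<close>, so \<open>end_nbhd K \<Omega> F j\<close> need not be open;
  only its Euclidean part has to be thickened.
\<close>

lemma openin_end_compactification_thicken:
  assumes F: "End F \<in> end_carrier K \<Omega>" and "open O'" and sub: "F j \<subseteq> O'"
  shows "openin (end_compactification K \<Omega>)
     (Pt ` (O' \<inter> closure \<Omega>) \<union> End ` {G \<in> ends_of (closure \<Omega>) K. \<forall>i\<le>j. G i = F i})"
  unfolding openin_end_compactification
proof (intro conjI allI impI)
  note F' = end_carrierD[OF F]
  show "Pt ` (O' \<inter> closure \<Omega>) \<union> End ` {G \<in> ends_of (closure \<Omega>) K. \<forall>i\<le>j. G i = F i}
      \<subseteq> end_carrier K \<Omega>"
    using F'(2) by (auto simp: end_carrier_def)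
  fix x assume "Pt x \<in> Pt ` (O' \<inter> closure \<Omega>) \<union> End ` {G \<in> ends_of (closure \<Omega>) K. \<forall>i\<le>j. G i = F i}"
  then have "x \<in> O'" by auto
  then obtain e where "e > 0" "ball x e \<subseteq> O'"
    using \<open>open O'\<close> open_contains_ball by blast
  then show "\<exists>e>0. Pt ` (ball x e \<inter> closure \<Omega>) \<subseteq>
      Pt ` (O' \<inter> closure \<Omega>) \<union> End ` {G \<in> ends_of (closure \<Omega>) K. \<forall>i\<le>j. G i = F i}"
    by (intro exI[of _ e]) auto
next
  fix G assume "End G \<in> Pt ` (O' \<inter> closure \<Omega>) \<union> End ` {G \<in> ends_of (closure \<Omega>) K. \<forall>i\<le>j. G i = F i}"
  then have G: "\<forall>i\<le>j. G i = F i" by auto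
  have "F j \<subseteq> closure \<Omega>"
    using end_carrierD[OF F] in_components_subset by (fastforce simp: ends_of_def)
  then show "\<exists>n. end_nbhd K \<Omega> G n \<subseteq>
      Pt ` (O' \<inter> closure \<Omega>) \<union> End ` {G \<in> ends_of (closure \<Omega>) K. \<forall>i\<le>j. G i = F i}"
    using sub G by (intro exI[of _ j]) (auto simp: end_nbhd_def)
qed

lemma openin_end_compactification_Pt:
  assumes "open O'"
  shows "openin (end_compactification K \<Omega>) (Pt ` (O' \<inter> closure \<Omega>))"
  unfolding openin_end_compactification
proof (intro conjI allI impI)
  fix x assume "Pt x \<in> Pt ` (O' \<inter> closure \<Omega>)"
  then have "x \<in> O'" by auto
  then obtain e where "e > 0" "ball x e \<subseteq> O'"
    using \<open>open O'\<close> open_contains_ball by blast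
  then show "\<exists>e>0. Pt ` (ball x e \<inter> closure \<Omega>) \<subseteq> Pt ` (O' \<inter> closure \<Omega>)"
    by (intro exI[of _ e]) auto
qed auto

lemma continuous_map_Pt:
  "continuous_map (top_of_set (closure \<Omega>)) (end_compactification K \<Omega>) Pt"
  unfolding continuous_map
proof (intro conjI allI impI)
  show "Pt ` topspace (top_of_set (closure \<Omega>)) \<subseteq> topspace (end_compactification K \<Omega>)"
    by auto
  fix U assume U: "openin (end_compactification K \<Omega>) U"
  show "openin (top_of_set (closure \<Omega>)) {x \<in> topspace (top_of_set (closure \<Omega>)). Pt x \<in> U}"
    unfolding openin_contains_ball
  proof (intro conjI ballI)
    fix x assume "x \<in> {x \<in> topspace (top_of_set (closure \<Omega>)). Pt x \<in> U}"
    then obtain e where "e > 0" "Pt ` (ball x e \<inter> closure \<Omega>) \<subseteq> U"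
      using U by (auto simp: openin_end_compactification)
    then show "\<exists>e>0. ball x e \<inter> closure \<Omega> \<subseteq> {x \<in> topspace (top_of_set (closure \<Omega>)). Pt x \<in> U}"
      by (intro exI[of _ e]) auto
  qed auto
qed

text \<open>One level is lost: \<open>x\<close> may be a boundary point of the \<open>K j\<close>
  that contains it, but \<open>K (Suc j)\<close> contains a relative neighbourhood of
  \<open>x\<close>, and its complement contains \<open>F (Suc j)\<close>.\<close>

lemma end_compactification_separate_Pt_End:
  fixes K :: "nat \<Rightarrow> 'a::metric_space set"
  assumes ex: "compact_exhaustion (closure \<Omega>) K"
    and x: "x \<in> closure \<Omega>" and F: "End F \<in> end_carrier K \<Omega>"
  shows "\<exists>U V. openin (end_compactification K \<Omega>) U \<and> openin (end_compactification K \<Omega>) V \<and>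
      Pt x \<in> U \<and> End F \<in> V \<and> disjnt U V"
proof -
  obtain j where j: "x \<in> K j"
    using x compact_exhaustion_props(4)[OF ex] by blast
  obtain O' where O': "open O'" "K j \<subseteq> O'" "O' \<inter> closure \<Omega> \<subseteq> K (Suc j)"
    using compact_exhaustion_interior[OF ex] .
  define V where "V = Pt ` (- K (Suc j) \<inter> closure \<Omega>) \<union>
      End ` {G \<in> ends_of (closure \<Omega>) K. \<forall>i\<le>Suc j. G i = F i}"
  have "open (- K (Suc j))"
    using compact_exhaustion_props(1)[OF ex] compact_imp_closed by blast
  moreover have "F (Suc j) \<subseteq> - K (Suc j)"
    using end_carrierD(1)[OF F] in_components_subset by (fastforce simp: ends_of_def)
  ultimately have "openin (end_compactification K \<Omega>) V"
    unfolding V_def using F by (intro openin_end_compactification_thicken) auto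
  moreover have "End F \<in> V"
    using end_carrierD(1)[OF F] by (auto simp: V_def)
  moreover have "disjnt (Pt ` (O' \<inter> closure \<Omega>)) V"
    using O' by (auto simp: V_def disjnt_def)
  moreover have "Pt x \<in> Pt ` (O' \<inter> closure \<Omega>)"
    using x j O' by auto
  ultimately show ?thesis
    using openin_end_compactification_Pt[OF O'(1)] by blast
qed

text \<open>At some level the two components differ, hence are disjoint, and each misses the closure
  of the other since components are relatively closed. Comparing the distances to the two gives
  disjoint open thickenings.\<close>

lemma end_compactification_separate_End_End:
  fixes K :: "nat \<Rightarrow> 'a::metric_space set"
  assumes ex: "compact_exhaustion (closure \<Omega>) K"
    and F: "End F \<in> end_carrier K \<Omega>" and G: "End G \<in> end_carrier K \<Omega>" and "F \<noteq> G"
  shows "\<exists>U V. openin (end_compactification K \<Omega>) U \<and> openin (end_compactification K \<Omega>) V \<and>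
      End F \<in> U \<and> End G \<in> V \<and> disjnt U V"
proof -
  let ?S = "closure \<Omega>"
  obtain j where j: "F j \<noteq> G j" using \<open>F \<noteq> G\<close> by blast
  have comp: "F j \<in> components (?S - K j)" "G j \<in> components (?S - K j)"
    using end_carrierD(1)[OF F] end_carrierD(1)[OF G] by (auto simp: ends_of_def)
  have disj: "F j \<inter> G j = {}"
    using comp j components_nonoverlap by blast
  have sub: "F j \<subseteq> ?S - K j" "G j \<subseteq> ?S - K j"
    using comp in_components_subset by blast+
  define A B where "A = {x. infdist x (F j) < infdist x (G j)}" and "B = {x. infdist x (G j) < infdist x (F j)}"
  have "open A" "open B"
    unfolding A_def B_def by (intro open_Collect_less continuous_intros)+
  have *: "x \<notin> closure C'" if "C \<in> components (?S - K j)" "C' \<in> components (?S - K j)" "C \<inter> C' = {}" "x \<in> C" for x C C'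
  proof
    assume "x \<in> closure C'"
    have "closedin (top_of_set (?S - K j)) C'"
      using that(2) closedin_component by blast
    then obtain D where "closed D" "C' = (?S - K j) \<inter> D"
      unfolding closedin_closed by blast
    moreover have "closure C' \<subseteq> D"
      using calculation by (simp add: closure_minimal)
    moreover have "x \<in> ?S - K j" using that in_components_subset by blast
    ultimately show False using \<open>x \<in> closure C'\<close> that by blast
  qed
  have ne: "F j \<noteq> {}" "G j \<noteq> {}" using comp in_components_nonempty by blast+
  have pos: "infdist x C > 0" if "x \<notin> closure C" "C \<noteq> {}" for x and C :: "'a set"
    using that in_closure_iff_infdist_zero[of C x] infdist_nonneg[of x C] by fastforce
  have "infdist x (G j) > 0" if "x \<in> F j" for x
    by (rule pos[OF *[OF comp disj that] ne(2)])
  then have "F j \<subseteq> A"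
    by (auto simp: A_def)
  have "G j \<inter> F j = {}" using disj by blast
  then have "infdist x (F j) > 0" if "x \<in> G j" for x
    using pos[OF *[OF comp(2,1) _ that] ne(1)] by blast
  then have "G j \<subseteq> B"
    by (auto simp: B_def)
  have "A \<inter> B = {}" by (auto simp: A_def B_def)
  define U V where "U = Pt ` (A \<inter> ?S) \<union> End ` {H \<in> ends_of ?S K. \<forall>i\<le>j. H i = F i}"
    and "V = Pt ` (B \<inter> ?S) \<union> End ` {H \<in> ends_of ?S K. \<forall>i\<le>j. H i = G i}"
  show ?thesis
  proof (rule exI[of _ U], rule exI[of _ V], intro conjI)
    show "openin (end_compactification K \<Omega>) U"
      unfolding U_def by (rule openin_end_compactification_thicken) fact+
    show "openin (end_compactification K \<Omega>) V"
      unfolding V_def by (rule openin_end_compactification_thicken) fact+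
    show "End F \<in> U" "End G \<in> V"
      using end_carrierD(1)[OF F] end_carrierD(1)[OF G] by (auto simp: U_def V_def)
    show "disjnt U V"
      using \<open>A \<inter> B = {}\<close> j unfolding U_def V_def disjnt_def by fastforce
  qed
qed

lemma Hausdorff_space_end_compactification:
  fixes K :: "nat \<Rightarrow> 'a::metric_space set"
  assumes ex: "compact_exhaustion (closure \<Omega>) K"
  shows "Hausdorff_space (end_compactification K \<Omega>)"
  unfolding Hausdorff_space_def
proof (intro allI impI, elim conjE)
  fix x y assume x: "x \<in> topspace (end_compactification K \<Omega>)" 
    and y: "y \<in> topspace (end_compactification K \<Omega>)" and "x \<noteq> y"
  show "\<exists>U V. openin (end_compactification K \<Omega>) U \<and> openin (end_compactification K \<Omega>) V \<and>
      x \<in> U \<and> y \<in> V \<and> disjnt U V"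
  proof (cases x)
    case (Pt u)
    show ?thesis
    proof (cases y)
      fix v assume v: "y = Pt v"
      then have "u \<noteq> v" using Pt \<open>x \<noteq> y\<close> by simp
      then obtain A B where "open A" "open B" "u \<in> A" "v \<in> B" "A \<inter> B = {}"
        using hausdorff[of u v] by auto
      then show ?thesis using Pt v x y
        by (intro exI[of _ "Pt ` (A \<inter> closure \<Omega>)"] exI[of _ "Pt ` (B \<inter> closure \<Omega>)"])
           (auto simp: openin_end_compactification_Pt disjnt_def)
    next
      fix G assume "y = End G"
      then show ?thesis
        using end_compactification_separate_Pt_End[OF ex, of u G] x y Pt by auto
    qed
  next
    case (End F)
    show ?thesis
    proof (cases y)
      fix v assume "y = Pt v"
      then show ?thesis
        using end_compactification_separate_Pt_End[OF ex, of v F] x y End disjnt_sym by (metis end_carrier_Pt topspace_end_compactification)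
    next
      fix G assume "y = End G"
      then show ?thesis
        using end_compactification_separate_End_End[OF ex, of F G] x y End \<open>x \<noteq> y\<close> by auto
    qed
  qed
qed

section \<open>Compactness of the end compactification\<close>

text \<open>
  As in Koenig's lemma: if a cover has no finite subcover, the components that, together with the
  ends through them, are not finitely covered form a tree with finite branching, and an infinite
  branch is an end.
\<close>

lemma compact_space_end_compactification:
  fixes K :: "nat \<Rightarrow> 'a::heine_borel set"
  assumes ex: "compact_exhaustion (closure \<Omega>) K"
    and fin: "\<And>j. finite {E \<in> components (closure \<Omega> - K j). \<not> E \<subseteq> K (j + m)}"
  shows "compact_space (end_compactification K \<Omega>)"
proof (cases "bounded \<Omega>")
  case True
  then have "compactin (top_of_set (closure \<Omega>)) (closure \<Omega>)"
    by (simp add: compactin_subtopology)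
  then have "compactin (end_compactification K \<Omega>) (Pt ` closure \<Omega>)"
    using continuous_map_Pt image_compactin by blast
  then show ?thesis
    using True by (simp add: compact_space_def end_carrier_def)
next
  case False
  let ?X = "end_compactification K \<Omega>" and ?S = "closure \<Omega>"
  \<comment> \<open>Only level \<open>j\<close> is prescribed; for an end this fixes all lower
    levels, so \<open>trunk j (F j)\<close> coincides with the basic neighbourhood of an end
    \<open>F\<close>.\<close>
  define trunk where "trunk j E = Pt ` E \<union> End ` {G \<in> ends_of ?S K. G j = E}" for j E
  show ?thesis
    unfolding compact_space_alt
  proof (intro allI impI, elim conjE)
    fix \<U> assume op: "\<forall>U\<in>\<U>. openin ?X U" and cov: "topspace ?X \<subseteq> \<Union>\<U>"
    define good where "good A \<longleftrightarrow> (\<exists>\<F>. finite \<F> \<and> \<F> \<subseteq> \<U> \<and> A \<subseteq> \<Union>\<F>)" for A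
    have good_Un: "good (A \<union> B)" if A: "good A" and B: "good B" for A B
    proof -
      obtain FA FB where "finite FA" "FA \<subseteq> \<U>" "A \<subseteq> \<Union>FA" "finite FB" "FB \<subseteq> \<U>" "B \<subseteq> \<Union>FB"
        using A B unfolding good_def by blast
      then show ?thesis unfolding good_def by (intro exI[of _ "FA \<union> FB"]) auto
    qed
    have good_mono: "good A" if "good B" "A \<subseteq> B" for A B
      using that unfolding good_def by blast
    have good_UN: "good (\<Union>i\<in>I. A i)" if "finite I" "\<And>i. i \<in> I \<Longrightarrow> good (A i)" for I and A :: "'a set \<Rightarrow> _"
      using that
    proof (induction I)
      case empty show ?case unfolding good_def by (intro exI[of _ "{}"]) auto
    qed (auto intro!: good_Un)
    have good_K: "good (Pt ` K j)" for j
    proof -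
      have "compactin (top_of_set ?S) (K j)"
        using compact_exhaustion_props[OF ex] by (simp add: compactin_subtopology)
      then have "compactin ?X (Pt ` K j)"
        using continuous_map_Pt image_compactin by blast
      moreover have "Pt ` K j \<subseteq> \<Union>\<U>"
      proof -
        have "Pt ` K j \<subseteq> Pt ` ?S" using compact_exhaustion_props(2)[OF ex] by blast
        also have "\<dots> \<subseteq> topspace ?X" by auto
        finally show ?thesis using cov by blast
      qed
      ultimately show ?thesis
        using op unfolding compactin_def good_def by (metis (no_types, lifting))
    qed
    \<comment> \<open>Were all these trunks finitely covered, \<open>B\<close> would be too: only
      finitely many components leave \<open>K (j + m)\<close>, and the others, however many, lie in
      this compact set, which \<open>good_K\<close> covers at once.\<close>
    have split: "\<exists>E \<in> components (?S - K j). E \<subseteq> A \<and> \<not> good (trunk j E)"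
      if bad: "\<not> good B" and B: "B \<subseteq> Pt ` K j \<union> (\<Union>E\<in>{E \<in> components (?S - K j). E \<subseteq> A}. trunk j E)" for j A B
    proof (rule ccontr)
      assume "\<not> ?thesis"
      then have "good (\<Union>E\<in>{E \<in> components (?S - K j). \<not> E \<subseteq> K (j + m)} \<inter> {E. E \<subseteq> A}. trunk j E)"
        using fin by (intro good_UN) auto
      moreover have "good (Pt ` K (j + m))" "good (Pt ` K j)" by (rule good_K)+
      ultimately have "good (Pt ` K (j + m) \<union> Pt ` K j \<union> (\<Union>E\<in>{E \<in> components (?S - K j). \<not> E \<subseteq> K (j + m)} \<inter> {E. E \<subseteq> A}. trunk j E))"
        by (intro good_Un)
      then have "good B"
      proof (rule good_mono, intro subsetI)
        fix x assume "x \<in> B"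
        with B have "x \<in> Pt ` K j \<union> (\<Union>E\<in>{E \<in> components (?S - K j). E \<subseteq> A}. trunk j E)" by (rule subsetD)
        then consider "x \<in> Pt ` K j" | E where "E \<in> components (?S - K j)" "E \<subseteq> A" "x \<in> trunk j E"
          by blast
        then show "x \<in> Pt ` K (j + m) \<union> Pt ` K j \<union> (\<Union>E\<in>{E \<in> components (?S - K j). \<not> E \<subseteq> K (j + m)} \<inter> {E. E \<subseteq> A}. trunk j E)"
        proof cases
          case 2
          show ?thesis
          proof (cases "E \<subseteq> K (j + m)")
            case True
            \<comment> \<open>An end through \<open>E\<close> would have its nonempty component
              \<open>G (j + m)\<close> inside \<open>E\<close> and off \<open>K (j + m)\<close> at
              the same time.\<close>
            have no_end: "{G \<in> ends_of ?S K. G j = E} = {}"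
            proof (rule ccontr)
              assume "\<not> ?thesis"
              then obtain G where G: "G \<in> ends_of ?S K" "G j = E" by blast
              then have "G (j + m) \<subseteq> E" using ends_of_antimono[of G ?S K j "j + m"] by simp
              moreover have "G (j + m) \<in> components (?S - K (j + m))"
                using G by (auto simp: ends_of_def)
              then have "G (j + m) \<noteq> {}" "G (j + m) \<subseteq> ?S - K (j + m)"
                using in_components_nonempty in_components_subset by blast+
              ultimately show False using True by blast
            qed
            have "trunk j E = Pt ` E" unfolding trunk_def no_end by simp
            with True 2(3) have "x \<in> Pt ` K (j + m)" by (metis image_mono subsetD)
            then show ?thesis by simp
          next
            case False
            with 2 show ?thesis by (intro UnI2) (rule UN_I, auto)
          qed
        qed simp
      qed
      then show False using bad by (rule notE[rotated])
    qed
    show "\<exists>\<F>. finite \<F> \<and> \<F> \<subseteq> \<U> \<and> topspace ?X \<subseteq> \<Union>\<F>"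
    proof (rule ccontr)
      assume "\<not> ?thesis"
      then have bad: "\<not> good (topspace ?X)" by (simp add: good_def)
      define P where "P j E \<longleftrightarrow> E \<in> components (?S - K j) \<and> \<not> good (trunk j E)" for j E
      have "\<exists>f. \<forall>n. P n (f n) \<and> f (Suc n) \<subseteq> f n"
      proof (rule dependent_nat_choice)
        have "topspace ?X \<subseteq> Pt ` K 0 \<union> (\<Union>E\<in>{E \<in> components (?S - K 0). E \<subseteq> UNIV}. trunk 0 E)"
        proof
          fix y assume y: "y \<in> topspace ?X"
          show "y \<in> Pt ` K 0 \<union> (\<Union>E\<in>{E \<in> components (?S - K 0). E \<subseteq> UNIV}. trunk 0 E)"
          proof (cases y)
            case (Pt x)
            then have "x \<in> ?S" using y by simp
            show ?thesis
            proof (cases "x \<in> K 0")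
              case False
              then obtain E where "E \<in> components (?S - K 0)" "x \<in> E"
                using \<open>x \<in> ?S\<close> obtain_component by (metis DiffI)
              then show ?thesis using Pt unfolding trunk_def by blast
            qed (use Pt in auto)
          next
            case (End G)
            then have "G \<in> ends_of ?S K" using y end_carrierD by auto
            moreover from this have "G 0 \<in> components (?S - K 0)" by (simp add: ends_of_def)
            ultimately show ?thesis using End unfolding trunk_def by blast
          qed
        qed
        then show "\<exists>E. P 0 E" using split[OF bad, of 0 UNIV] unfolding P_def by blast
      next
        fix E j assume P: "P j E"
        have "trunk j E \<subseteq> Pt ` K (Suc j) \<union> (\<Union>E'\<in>{E' \<in> components (?S - K (Suc j)). E' \<subseteq> E}. trunk (Suc j) E')"
        proof
          fix y assume y: "y \<in> trunk j E"
          show "y \<in> Pt ` K (Suc j) \<union> (\<Union>E'\<in>{E' \<in> components (?S - K (Suc j)). E' \<subseteq> E}. trunk (Suc j) E')"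
          proof (cases y)
            case (Pt x)
            then have x: "x \<in> E" using y by (auto simp: trunk_def)
            have E: "E \<in> components (?S - K j)" using P by (simp add: P_def)
            show ?thesis
            proof (cases "x \<in> K (Suc j)")
              case True
              then show ?thesis using Pt by auto
            next
              case False
              have "x \<in> ?S" using x E in_components_subset by blast
              then obtain E' where E': "E' \<in> components (?S - K (Suc j))" "x \<in> E'"
                using False \<open>x \<in> ?S\<close> obtain_component by (metis DiffI)
              have "E' \<subseteq> E"
              proof (rule components_maximal[OF E])
                show "connected E'" using E' in_components_connected by blast
                show "E' \<subseteq> ?S - K j"
                  using in_components_subset[OF E'(1)] compact_exhaustion_props(3)[OF ex, of j] by blast
                show "E \<inter> E' \<noteq> {}" using x E' by auto
              qed
              then show ?thesis using E' Pt unfolding trunk_def by blast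
            qed
          next
            case (End G)
            then have "G \<in> ends_of ?S K" "G j = E" using y by (auto simp: trunk_def)
            moreover from this have "G (Suc j) \<in> components (?S - K (Suc j))" "G (Suc j) \<subseteq> E"
              by (auto simp: ends_of_def)
            ultimately show ?thesis using End unfolding trunk_def by blast
          qed
        qed
        moreover have "\<not> good (trunk j E)" using P by (simp add: P_def)
        ultimately show "\<exists>E'. P (Suc j) E' \<and> E' \<subseteq> E"
          using split[of "trunk j E" "Suc j" E] unfolding P_def by blast
      qed
      then obtain F where F: "\<And>n. P n (F n)" "\<And>n. F (Suc n) \<subseteq> F n" by blast
      then have end': "F \<in> ends_of ?S K" by (auto simp: ends_of_def P_def)
      then have "End F \<in> topspace ?X" using False by (auto simp: end_carrier_def)
      then obtain U where U: "U \<in> \<U>" "End F \<in> U" using cov by blast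
      then obtain j where j: "end_nbhd K \<Omega> F j \<subseteq> U"
        using op by (metis openin_end_compactification)
      \<comment> \<open>One member of the cover contains a basic neighbourhood of the new end, hence
        a whole trunk that was chosen not to be finitely covered.\<close>
      have "trunk j (F j) \<subseteq> U"
        using j ends_of_eq_below[OF _ end'] unfolding trunk_def end_nbhd_def by blast
      then have "good (trunk j (F j))"
        unfolding good_def using U by (intro exI[of _ "{U}"]) auto
      then show False using F by (auto simp: P_def)
    qed
  qed
qed

text \<open>Every component counted in the conclusion contains a component counted in
  \<open>fin\<close>, so choosing for each \<open>U\<close> the component around it maps a finite
  set onto the wanted one.\<close>

lemma finite_components_closure:
  fixes \<Omega> :: "'a::topological_space set"
  assumes "closed B" and AB: "A \<subseteq> B"
    and fin: "finite {U \<in> components (\<Omega> - A). \<not> U \<subseteq> B}" (is "finite ?\<U>")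
  shows "finite {E \<in> components (closure \<Omega> - A). \<not> E \<subseteq> B}"
proof (rule finite_subset)
  let ?f = "\<lambda>U. SOME E. E \<in> components (closure \<Omega> - A) \<and> U \<subseteq> E"
  show "finite (?f ` ?\<U>)" using fin by simp
  show "{E \<in> components (closure \<Omega> - A). \<not> E \<subseteq> B} \<subseteq> ?f ` ?\<U>"
  proof
    fix E assume "E \<in> {E \<in> components (closure \<Omega> - A). \<not> E \<subseteq> B}"
    then obtain x where E: "E \<in> components (closure \<Omega> - A)" and x: "x \<in> E" "x \<notin> B" by blast
    have "\<Omega> - B \<subseteq> \<Union>?\<U>"
    proof
      fix y assume y: "y \<in> \<Omega> - B"
      then obtain U where "U \<in> components (\<Omega> - A)" "y \<in> U"
        using obtain_component[of y "\<Omega> - A"] AB by blast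
      then show "y \<in> \<Union>?\<U>" using y by blast
    qed
    also have "\<dots> \<subseteq> (\<Union>U\<in>?\<U>. closure U)"
      using closure_subset by blast
    \<comment> \<open>Finiteness makes the union of the closures closed; otherwise a limit point
      could arise from infinitely many different components.\<close>
    finally have "closure (\<Omega> - B) \<subseteq> (\<Union>U\<in>?\<U>. closure U)"
      using fin by (intro closure_minimal closed_UN) auto
    moreover have "x \<in> closure (\<Omega> - B)"
    proof -
      have "x \<in> (- B) \<inter> closure \<Omega>" using x E in_components_subset by blast
      also have "\<dots> \<subseteq> closure ((- B) \<inter> \<Omega>)"
        using \<open>closed B\<close> by (intro open_Int_closure_subset) auto
      finally show ?thesis by (simp add: Diff_eq Int_commute)
    qed
    ultimately obtain U where U: "U \<in> components (\<Omega> - A)" "\<not> U \<subseteq> B" "x \<in> closure U" by blast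
    \<comment> \<open>Adding limit points outside \<open>A\<close> keeps \<open>U\<close> connected,
      so the single point \<open>x\<close> in \<open>E\<close> draws the whole set into
      \<open>E\<close>.\<close>
    have "connected (closure U - A)"
    proof (rule connected_intermediate_closure)
      show "connected U" using U in_components_connected by blast
      show "U \<subseteq> closure U - A" using in_components_subset[OF U(1)] closure_subset by blast
    qed auto
    moreover have "closure U - A \<subseteq> closure \<Omega> - A"
      using in_components_subset[OF U(1)] closure_mono[of U \<Omega>] by blast
    moreover have "E \<inter> (closure U - A) \<noteq> {}" using x U AB by blast
    ultimately have "closure U - A \<subseteq> E"
      using components_maximal[OF E] by blast
    then have UE: "U \<subseteq> E"
      using in_components_subset[OF U(1)] closure_subset by blast
    have "U \<noteq> {}" using U(1) in_components_nonempty by blast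
    have "?f U = E"
    proof (rule some_equality)
      fix E' assume "E' \<in> components (closure \<Omega> - A) \<and> U \<subseteq> E'"
      with UE \<open>U \<noteq> {}\<close> E show "E' = E" using components_nonoverlap by blast
    qed (use E UE in simp)
    then show "E \<in> ?f ` ?\<U>" using U by blast
  qed
qed

section \<open>Compactness arguments in abstract topological spaces\<close>

text \<open>\<open>Q\<close> passes to the union of a finite subcover. In the applications
  \<open>Q\<close> itself asserts the existence of a neighbourhood in a second variable.\<close>

lemma compactin_induct_open:
  assumes A: "compactin X A"
    and loc: "\<And>a. a \<in> A \<Longrightarrow> \<exists>V. openin X V \<and> a \<in> V \<and> Q V"
    and empty: "Q {}" and Un: "\<And>V V'. Q V \<Longrightarrow> Q V' \<Longrightarrow> Q (V \<union> V')"
  shows "\<exists>V. openin X V \<and> A \<subseteq> V \<and> Q V"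
proof -
  let ?\<U> = "{V. openin X V \<and> Q V}"
  have "A \<subseteq> \<Union>?\<U>"
    using loc by blast
  then obtain \<F> where \<F>: "finite \<F>" "\<F> \<subseteq> ?\<U>" "A \<subseteq> \<Union>\<F>"
    using compactinD[OF A, of ?\<U>] by auto
  have "Q (\<Union>\<F>)"
    using \<F>(1,2) by (induction \<F>) (auto intro: empty Un)
  moreover have "openin X (\<Union>\<F>)" using \<F>(2) by auto
  ultimately show ?thesis using \<F>(3) by blast
qed

text \<open>A tube lemma for relations: fix a point of \<open>A\<close>, cover \<open>B\<close> and
  intersect the neighbourhoods of the point; then cover \<open>A\<close> and intersect the
  neighbourhoods of \<open>B\<close>. Monotonicity allows the intersections, stability under unions
  the covers.\<close>

lemma compactin_tube:
  assumes A: "compactin X A" and B: "compactin X B"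
    and loc: "\<And>a b. a \<in> A \<Longrightarrow> b \<in> B \<Longrightarrow> \<exists>V W. openin X V \<and> openin X W \<and> a \<in> V \<and> b \<in> W \<and> P V W"
    and mono: "\<And>V W V' W'. P V W \<Longrightarrow> V' \<subseteq> V \<Longrightarrow> W' \<subseteq> W \<Longrightarrow> P V' W'"
    and empty: "\<And>V. P V {}" "\<And>W. P {} W"
    and UnL: "\<And>V V' W. P V W \<Longrightarrow> P V' W \<Longrightarrow> P (V \<union> V') W"
    and UnR: "\<And>V W W'. P V W \<Longrightarrow> P V W' \<Longrightarrow> P V (W \<union> W')"
  shows "\<exists>V W. openin X V \<and> openin X W \<and> A \<subseteq> V \<and> B \<subseteq> W \<and> P V W"
proof -
  have inner: "\<exists>W. openin X W \<and> B \<subseteq> W \<and> (\<exists>V. openin X V \<and> a \<in> V \<and> P V W)" if "a \<in> A" for a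
  proof (rule compactin_induct_open[OF B])
    show "\<exists>V. openin X V \<and> a \<in> V \<and> P V {}"
      using that compactin_subset_topspace[OF A] empty(1) by (intro exI[of _ "topspace X"]) auto
    fix W W' assume "\<exists>V. openin X V \<and> a \<in> V \<and> P V W" "\<exists>V. openin X V \<and> a \<in> V \<and> P V W'"
    then obtain V V' where V: "openin X V" "a \<in> V" "P V W" "openin X V'" "a \<in> V'" "P V' W'" by metis
    then have "P (V \<inter> V') (W \<union> W')"
      using mono[of V W "V \<inter> V'" W] mono[of V' W' "V \<inter> V'" W'] by (intro UnR) auto
    then show "\<exists>V. openin X V \<and> a \<in> V \<and> P V (W \<union> W')"
      using V by (intro exI[of _ "V \<inter> V'"]) auto
  next
    fix b assume "b \<in> B"
    then show "\<exists>W. openin X W \<and> b \<in> W \<and> (\<exists>V. openin X V \<and> a \<in> V \<and> P V W)"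
      using loc[OF that] by metis
  qed
  have "\<exists>V. openin X V \<and> A \<subseteq> V \<and> (\<exists>W. openin X W \<and> B \<subseteq> W \<and> P V W)"
  proof (rule compactin_induct_open[OF A])
    show "\<exists>W. openin X W \<and> B \<subseteq> W \<and> P {} W"
      using compactin_subset_topspace[OF B] empty(2) by (intro exI[of _ "topspace X"]) auto
    fix V V' assume "\<exists>W. openin X W \<and> B \<subseteq> W \<and> P V W" "\<exists>W. openin X W \<and> B \<subseteq> W \<and> P V' W"
    then obtain W W' where W: "openin X W" "B \<subseteq> W" "P V W" "openin X W'" "B \<subseteq> W'" "P V' W'" by metis
    then have "P (V \<union> V') (W \<inter> W')"
      using mono[of V W V "W \<inter> W'"] mono[of V' W' V' "W \<inter> W'"] by (intro UnL) auto
    then show "\<exists>W. openin X W \<and> B \<subseteq> W \<and> P (V \<union> V') W"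
      using W by (intro exI[of _ "W \<inter> W'"]) auto
  next
    fix a assume "a \<in> A"
    then show "\<exists>V. openin X V \<and> a \<in> V \<and> (\<exists>W. openin X W \<and> B \<subseteq> W \<and> P V W)"
      using inner[of a] by metis
  qed
  then show ?thesis by metis
qed

text \<open>Hausdorff separation gives disjoint open sets only. Regularity shrinks one of them to a
  set with closure inside \<open>U\<close>, and \<open>U\<close>, being open and disjoint from
  \<open>V\<close>, misses the closure of \<open>V\<close>.\<close>

lemma compact_Hausdorff_disjoint_closures:
  assumes "compact_space X" "Hausdorff_space X" and "x \<in> topspace X" "y \<in> topspace X" "x \<noteq> y"
  obtains V W where "openin X V" "openin X W" "x \<in> V" "y \<in> W" "X closure_of V \<inter> X closure_of W = {}"
proof -
  obtain V U where VU: "openin X V" "openin X U" "x \<in> V" "y \<in> U" "disjnt V U"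
    using assms by (metis Hausdorff_space_def)
  have "neighbourhood_base_of (closedin X) X"
    using assms compact_Hausdorff_imp_regular_space neighbourhood_base_of_closedin by blast
  then obtain W D where W: "openin X W" "closedin X D" "y \<in> W" "W \<subseteq> D" "D \<subseteq> U"
    using VU by (metis neighbourhood_base_of)
  have "X closure_of W \<subseteq> U"
    using W closure_of_minimal[of W D X] by blast
  moreover have "X closure_of V \<inter> U = {}"
    using VU openin_Int_closure_of_eq_empty[of X U V] by (auto simp: disjnt_def)
  ultimately show thesis using that[of V W] VU W by blast
qed

section \<open>Derivatives of analytic discs and the Poincare distance\<close>

definition disc_deriv :: "(complex \<Rightarrow> complex ^ 'd) \<Rightarrow> complex \<Rightarrow> complex ^ 'd" where
  "disc_deriv f \<zeta> = (\<chi> i. deriv (\<lambda>\<zeta>. f \<zeta> $ i) \<zeta>)"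

lemma has_derivative_vec_componentwise:
  fixes f :: "'a::real_normed_vector \<Rightarrow> 'b::euclidean_space ^ 'd"
  shows "(f has_derivative D) F \<longleftrightarrow> (\<forall>i. ((\<lambda>x. f x $ i) has_derivative (\<lambda>h. D h $ i)) F)"
proof (intro iffI allI)
  fix i assume "(f has_derivative D) F"
  then show "((\<lambda>x. f x $ i) has_derivative (\<lambda>h. D h $ i)) F"
    by (rule bounded_linear.has_derivative[OF bounded_linear_vec_nth])
next
  assume *: "\<forall>i. ((\<lambda>x. f x $ i) has_derivative (\<lambda>h. D h $ i)) F"
  have ax: "bounded_linear (axis i :: 'b \<Rightarrow> 'b ^ 'd)" for i
    unfolding linear_conv_bounded_linear[symmetric]
    by (rule linearI) (auto simp: vec_eq_iff axis_def)
  have sum: "(\<Sum>i\<in>UNIV. axis i (v $ i)) = v" for v :: "'b ^ 'd"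
    by (simp add: vec_eq_iff axis_def if_distrib cong: if_cong)
  have "((\<lambda>x. \<Sum>i\<in>UNIV. axis i (f x $ i)) has_derivative (\<lambda>h. \<Sum>i\<in>UNIV. axis i (D h $ i))) F"
    by (rule has_derivative_sum) (use * in \<open>auto intro: bounded_linear.has_derivative[OF ax]\<close>)
  then show "(f has_derivative D) F" by (simp add: sum)
qed

lemma has_derivative_vec_iff_field:
  fixes f :: "complex \<Rightarrow> complex ^ 'd"
  shows "(f has_derivative (\<lambda>h. h *s v)) (at \<zeta>) \<longleftrightarrow>
    (\<forall>i. ((\<lambda>\<zeta>. f \<zeta> $ i) has_field_derivative (v $ i)) (at \<zeta>))"
proof -
  have "(\<lambda>h. (h *s v) $ i) = (*) (v $ i)" for i
    by (simp add: fun_eq_iff mult.commute)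
  then show ?thesis
    unfolding has_derivative_vec_componentwise has_field_derivative_def by metis
qed

text \<open>Recasts componentwise holomorphy as one complex-linear derivative, the form in which the
  chain rule with a holomorphic map of several variables applies.\<close>

lemma analytic_disc_iff:
  "analytic_disc \<Omega> f \<longleftrightarrow>
     f ` ball 0 1 \<subseteq> \<Omega> \<and> (\<forall>\<zeta>\<in>ball 0 1. \<exists>v. (f has_derivative (\<lambda>h. h *s v)) (at \<zeta>))"
proof -
  have "(\<forall>i. (\<lambda>\<zeta>. f \<zeta> $ i) holomorphic_on ball 0 1) \<longleftrightarrow>
      (\<forall>\<zeta>\<in>ball 0 1. \<forall>i. \<exists>c. ((\<lambda>\<zeta>. f \<zeta> $ i) has_field_derivative c) (at \<zeta>))"
    by (auto simp: holomorphic_on_open)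
  also have "\<dots> \<longleftrightarrow> (\<forall>\<zeta>\<in>ball 0 1. \<exists>v. \<forall>i. ((\<lambda>\<zeta>. f \<zeta> $ i) has_field_derivative (v $ i)) (at \<zeta>))"
  proof (intro ball_cong refl iffI)
    fix \<zeta> assume "\<forall>i. \<exists>c. ((\<lambda>\<zeta>. f \<zeta> $ i) has_field_derivative c) (at \<zeta>)"
    then obtain c where "\<And>i. ((\<lambda>\<zeta>. f \<zeta> $ i) has_field_derivative c i) (at \<zeta>)" by metis
    then show "\<exists>v. \<forall>i. ((\<lambda>\<zeta>. f \<zeta> $ i) has_field_derivative (v $ i)) (at \<zeta>)"
      by (intro exI[of _ "\<chi> i. c i"]) simp
  qed blast
  finally show ?thesis
    by (auto simp: analytic_disc_def has_derivative_vec_iff_field)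
qed

lemma disc_deriv_eqI:
  assumes "(f has_derivative (\<lambda>h. h *s v)) (at \<zeta>)"
  shows "disc_deriv f \<zeta> = v"
  using assms by (simp add: has_derivative_vec_iff_field disc_deriv_def vec_eq_iff DERIV_imp_deriv)

lemma analytic_disc_has_derivative:
  assumes "analytic_disc \<Omega> f" "\<zeta> \<in> ball 0 1"
  shows "(f has_derivative (\<lambda>h. h *s disc_deriv f \<zeta>)) (at \<zeta>)"
  using assms disc_deriv_eqI unfolding analytic_disc_iff by metis

lemma analytic_disc_compose:
  assumes f: "analytic_disc \<Omega> f" and \<phi>: "\<phi> holomorphic_on ball 0 1" "\<phi> ` ball 0 1 \<subseteq> ball 0 1"
  shows "analytic_disc \<Omega> (f \<circ> \<phi>)"
proof -
  have "((\<lambda>\<zeta>. f \<zeta> $ i) \<circ> \<phi>) holomorphic_on ball 0 1" for i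
    using f \<phi> by (intro holomorphic_on_compose_gen[OF \<phi>(1) _ \<phi>(2)]) (auto simp: analytic_disc_def)
  then show ?thesis
    using f \<phi>(2) by (auto simp: analytic_disc_def o_def image_subset_iff)
qed

lemma analytic_disc_affine:
  assumes "\<And>\<zeta>. \<zeta> \<in> ball 0 1 \<Longrightarrow> z + \<zeta> *s v \<in> \<Omega>"
  shows "analytic_disc \<Omega> (\<lambda>\<zeta>. z + \<zeta> *s v)"
  using assms by (auto simp: analytic_disc_def intro!: holomorphic_intros)

lemma norm_vector_scalar_mult: "norm (c *s v) = cmod c * norm v" for v :: "complex ^ 'd"
  by (simp add: norm_vec_def L2_set_def norm_mult power_mult_distrib sum_distrib_left[symmetric] real_sqrt_mult)

text \<open>Recognises the quotient as a disc automorphism, whose bounds and inverse then become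
  available.\<close>

lemma poincare_dist_Moebius: "poincare_dist a b = artanh (cmod (Moebius_function 0 b a))"
  by (simp add: poincare_dist_def Moebius_function_simple)

lemma poincare_dist_commute: "poincare_dist a b = poincare_dist b a"
proof -
  have "cmod (1 - cnj b * a) = cmod (cnj (1 - cnj a * b))"
    by (simp add: mult.commute del: complex_mod_cnj)
  then show ?thesis
    by (simp add: poincare_dist_def norm_divide norm_minus_commute del: complex_cnj_diff complex_cnj_mult)
qed

lemma artanh_real_nonneg:
  assumes "0 \<le> (x::real)" "x < 1"
  shows "artanh x \<ge> 0"
  using assms by (auto simp: artanh_def intro!: ln_ge_zero divide_right_mono)

lemma poincare_dist_nonneg:
  assumes "a \<in> ball 0 1" "b \<in> ball 0 1"
  shows "poincare_dist a b \<ge> 0"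
  using assms Moebius_function_norm_lt_1[of b a 0]
  by (auto simp: poincare_dist_Moebius intro!: artanh_real_nonneg)

section \<open>Chains of discs and the Kobayashi distance\<close>

definition chain_lengths :: "(complex ^ 'd) set \<Rightarrow> complex ^ 'd \<Rightarrow> complex ^ 'd \<Rightarrow> real set" where
  "chain_lengths \<Omega> z w = {(\<Sum>j<n. poincare_dist (a j) (b j)) | n a b f p.
     p 0 = z \<and> p n = w \<and>
     (\<forall>j<n. analytic_disc \<Omega> (f j) \<and> a j \<in> ball 0 1 \<and> b j \<in> ball 0 1 \<and>
            f j (a j) = p j \<and> f j (b j) = p (Suc j))}"

lemma kobayashi_dist_eq_Inf: "kobayashi_dist \<Omega> z w = Inf (chain_lengths \<Omega> z w)"
  by (simp add: kobayashi_dist_def chain_lengths_def)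

lemma chain_lengths_Nil: "0 \<in> chain_lengths \<Omega> z z"
  unfolding chain_lengths_def
  by (intro CollectI exI[of _ 0] exI[of _ "\<lambda>_. 0"] exI[of _ "\<lambda>_. z"] exI[of _ "\<lambda>_ _. z"]) auto

lemma chain_lengths_snoc:
  assumes "L \<in> chain_lengths \<Omega> z (g c)" "analytic_disc \<Omega> g" "c \<in> ball 0 1" "d \<in> ball 0 1"
  shows "L + poincare_dist c d \<in> chain_lengths \<Omega> z (g d)"
proof -
  obtain n a b f p where *: "L = (\<Sum>j<n. poincare_dist (a j) (b j))" "p 0 = z" "p n = g c"
    "\<forall>j<n. analytic_disc \<Omega> (f j) \<and> a j \<in> ball 0 1 \<and> b j \<in> ball 0 1 \<and>
            f j (a j) = p j \<and> f j (b j) = p (Suc j)"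
    using assms(1) unfolding chain_lengths_def mem_Collect_eq by (elim exE conjE) (rule that)
  define a' where "a' = a(n := c)"
  define b' where "b' = b(n := d)"
  define f' where "f' = f(n := g)"
  define p' where "p' = p(Suc n := g d)"
  have "L + poincare_dist c d = (\<Sum>j<Suc n. poincare_dist (a' j) (b' j))"
    using *(1) by (simp add: a'_def b'_def)
  moreover have "p' 0 = z" "p' (Suc n) = g d"
    using * by (simp_all add: p'_def)
  moreover have "\<forall>j<Suc n. analytic_disc \<Omega> (f' j) \<and> a' j \<in> ball 0 1 \<and> b' j \<in> ball 0 1 \<and>
            f' j (a' j) = p' j \<and> f' j (b' j) = p' (Suc j)"
    using * assms(2-4) by (auto simp: a'_def b'_def f'_def p'_def less_Suc_eq)
  ultimately show ?thesis
    unfolding chain_lengths_def mem_Collect_eq by (intro exI conjI)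
qed

lemma chain_lengths_nonneg: "L \<in> chain_lengths \<Omega> z w \<Longrightarrow> L \<ge> 0"
  unfolding chain_lengths_def by (auto intro!: sum_nonneg poincare_dist_nonneg)

lemma bdd_below_chain_lengths: "bdd_below (chain_lengths \<Omega> z w)"
  using chain_lengths_nonneg by (rule bdd_belowI)

lemma kobayashi_dist_disc_le:
  assumes "analytic_disc \<Omega> f" "a \<in> ball 0 1" "b \<in> ball 0 1"
  shows "kobayashi_dist \<Omega> (f a) (f b) \<le> poincare_dist a b"
  unfolding kobayashi_dist_eq_Inf
  using chain_lengths_snoc[OF chain_lengths_Nil assms]
  by (auto intro!: cInf_lower bdd_below_chain_lengths)

lemma affine_disc_through:
  fixes z w :: "complex ^ 'd"
  assumes "ball z r \<subseteq> \<Omega>" "w \<in> ball z r"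
  obtains f c where "analytic_disc \<Omega> f" "c \<in> ball 0 1" "f 0 = z" "f c = w"
proof (cases "w = z")
  case True
  then have "z \<in> \<Omega>" using assms by auto
  then have "analytic_disc \<Omega> (\<lambda>\<zeta>. z)" by (auto simp: analytic_disc_def)
  then show thesis by (rule that[of _ 0]) (simp_all add: True)
next
  case False
  define n where "n = norm (w - z)"
  have n: "0 < n" "n < r" using False assms by (auto simp: n_def dist_norm norm_minus_commute)
  \<comment> \<open>Of norm \<open>r\<close>, so that the unit disc stays inside the ball and
    \<open>w\<close> sits at the parameter \<open>n / r < 1\<close>.\<close>
  define v where "v = of_real (r / n) *s (w - z)"
  have "norm v = norm (complex_of_real (r / n)) * n"
    unfolding v_def n_def by (rule norm_vector_scalar_mult)
  then have nv: "norm v = r" using n by (simp add: norm_divide)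
  have "analytic_disc \<Omega> (\<lambda>\<zeta>. z + \<zeta> *s v)"
  proof (rule analytic_disc_affine)
    fix \<zeta> :: complex assume "\<zeta> \<in> ball 0 1"
    then have "z + \<zeta> *s v \<in> ball z r"
      using nv n by (auto simp: dist_norm norm_vector_scalar_mult)
    then show "z + \<zeta> *s v \<in> \<Omega>" using assms by auto
  qed
  moreover have "of_real (n / r) \<in> ball (0::complex) 1"
    using n by (simp add: norm_divide)
  moreover have "z + of_real (n / r) *s v = w"
    using n by (simp add: v_def vec_eq_iff)
  ultimately show thesis using that[of "\<lambda>\<zeta>. z + \<zeta> *s v"] by simp
qed

text \<open>A point and the centre of a ball around it are joined by an affine disc, so the points
  reachable by chains form a nonempty clopen subset of \<open>\<Omega>\<close>. Nonemptiness is what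
  lets actual chains approach the infimum in \<open>kobayashi_dist\<close>.\<close>

lemma chain_lengths_nonempty:
  assumes "domain \<Omega>" "z \<in> \<Omega>" "w \<in> \<Omega>"
  shows "chain_lengths \<Omega> z w \<noteq> {}"
proof -
  have op: "open \<Omega>" and conn: "connected \<Omega>" using assms(1) by (auto simp: domain_def)
  define S where "S = {w \<in> \<Omega>. chain_lengths \<Omega> z w \<noteq> {}}"
  have step: "chain_lengths \<Omega> z v \<noteq> {} \<longleftrightarrow> chain_lengths \<Omega> z u \<noteq> {}"
    if ball: "ball u r \<subseteq> \<Omega>" "v \<in> ball u r" for u v r
  proof -
    obtain f c where f: "analytic_disc \<Omega> f" "c \<in> ball 0 1" "f 0 = u" "f c = v"
      using affine_disc_through[OF ball] .
    then show ?thesis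
      using chain_lengths_snoc[of _ \<Omega> z f 0 c] chain_lengths_snoc[of _ \<Omega> z f c 0]
      by (metis all_not_in_conv centre_in_ball zero_less_one)
  qed
  have "openin (top_of_set \<Omega>) S"
    unfolding openin_contains_ball
  proof (intro conjI ballI)
    fix u assume u: "u \<in> S"
    then obtain r where "r > 0" "ball u r \<subseteq> \<Omega>"
      using op by (metis (no_types, lifting) S_def mem_Collect_eq open_contains_ball)
    have "ball u r \<inter> \<Omega> \<subseteq> S"
    proof
      fix v assume "v \<in> ball u r \<inter> \<Omega>"
      then show "v \<in> S"
        using u step[OF \<open>ball u r \<subseteq> \<Omega>\<close>, of v] by (simp add: S_def)
    qed
    with \<open>r > 0\<close> show "\<exists>e>0. ball u e \<inter> \<Omega> \<subseteq> S" by metis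
  qed (auto simp: S_def)
  moreover have "closedin (top_of_set \<Omega>) S"
  proof -
    have "openin (top_of_set \<Omega>) (\<Omega> - S)"
      unfolding openin_contains_ball
    proof (intro conjI ballI)
      fix u assume u: "u \<in> \<Omega> - S"
      then obtain r where "r > 0" "ball u r \<subseteq> \<Omega>"
        using op by (metis DiffD1 open_contains_ball)
      have "ball u r \<inter> \<Omega> \<subseteq> \<Omega> - S"
      proof
        fix v assume "v \<in> ball u r \<inter> \<Omega>"
        then show "v \<in> \<Omega> - S"
          using u step[OF \<open>ball u r \<subseteq> \<Omega>\<close>, of v] by (simp add: S_def)
      qed
      with \<open>r > 0\<close> show "\<exists>e>0. ball u e \<inter> \<Omega> \<subseteq> \<Omega> - S" by metis
    qed auto
    then show ?thesis by (auto simp: closedin_def S_def)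
  qed
  moreover have "z \<in> S" using assms chain_lengths_Nil by (auto simp: S_def)
  ultimately have "S = \<Omega>"
    using conn unfolding connected_clopen by auto
  then show ?thesis using assms(3) by (auto simp: S_def)
qed

lemma hyperbolic_dist:
  assumes "hyperbolic \<Omega>"
  shows "x \<in> \<Omega> \<Longrightarrow> kobayashi_dist \<Omega> x x = 0"
    and "x \<in> \<Omega> \<Longrightarrow> y \<in> \<Omega> \<Longrightarrow> kobayashi_dist \<Omega> x y = kobayashi_dist \<Omega> y x"
    and "x \<in> \<Omega> \<Longrightarrow> y \<in> \<Omega> \<Longrightarrow> z \<in> \<Omega> \<Longrightarrow>
      kobayashi_dist \<Omega> x z \<le> kobayashi_dist \<Omega> x y + kobayashi_dist \<Omega> y z"
proof -
  interpret Metric_space \<Omega> "\<lambda>z w. if z \<in> \<Omega> \<and> w \<in> \<Omega> then kobayashi_dist \<Omega> z w else 0"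
    using assms by (simp add: hyperbolic_def)
  show "x \<in> \<Omega> \<Longrightarrow> kobayashi_dist \<Omega> x x = 0"
    using zero[of x x] by auto
  show "x \<in> \<Omega> \<Longrightarrow> y \<in> \<Omega> \<Longrightarrow> kobayashi_dist \<Omega> x y = kobayashi_dist \<Omega> y x"
    using commute[of x y] by auto
  show "x \<in> \<Omega> \<Longrightarrow> y \<in> \<Omega> \<Longrightarrow> z \<in> \<Omega> \<Longrightarrow>
      kobayashi_dist \<Omega> x z \<le> kobayashi_dist \<Omega> x y + kobayashi_dist \<Omega> y z"
    using triangle[of x y z] by auto
qed

section \<open>Unit-speed curves and the existence of almost-geodesics\<close>

text \<open>Speed is bounded from above only; the lower bound on distances is added once a curve is
  known to be nearly minimal. The finite exceptional set allows for the corners of concatenations,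
  and the Lipschitz condition yields absolute continuity.\<close>

definition unit_speed_curve :: "(complex ^ 'd) set \<Rightarrow> real \<Rightarrow> (real \<Rightarrow> complex ^ 'd) \<Rightarrow> bool" where
  "unit_speed_curve \<Omega> T \<sigma> \<longleftrightarrow>
     0 \<le> T \<and> \<sigma> ` {0..T} \<subseteq> \<Omega> \<and>
     (\<forall>s\<in>{0..T}. \<forall>t\<in>{0..T}. kobayashi_dist \<Omega> (\<sigma> s) (\<sigma> t) \<le> \<bar>s - t\<bar>) \<and>
     (\<exists>L. L-lipschitz_on {0..T} \<sigma>) \<and>
     (\<exists>N. finite N \<and> (\<forall>t\<in>{0..T} - N. \<exists>v. (\<sigma> has_vector_derivative v) (at t) \<and>
        kobayashi_royden \<Omega> (\<sigma> t) v \<le> 1))"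

lemma abs_continuous_on_lipschitz:
  assumes "L-lipschitz_on I \<sigma>"
  shows "abs_continuous_on I \<sigma>"
  unfolding abs_continuous_on_def
proof (intro allI impI)
  fix e :: real assume "e > 0"
  have L: "L \<ge> 0" using assms lipschitz_on_nonneg by blast
  show "\<exists>\<delta>>0. \<forall>(n::nat) a b.
        (\<forall>i<n. a i \<le> b i \<and> {a i..b i} \<subseteq> I) \<and>
        (\<forall>i<n. \<forall>j<n. i \<noteq> j \<longrightarrow> {a i<..<b i} \<inter> {a j<..<b j} = {}) \<and>
        (\<Sum>i<n. b i - a i) < \<delta>
        \<longrightarrow> (\<Sum>i<n. norm (\<sigma> (b i) - \<sigma> (a i))) < e"
  \<comment> \<open>\<open>L\<close> may be 0, hence the denominator \<open>L + 1\<close>.\<close>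
  proof (intro exI[of _ "e / (L + 1)"] conjI allI impI, goal_cases)
    case 1
    show ?case using \<open>e > 0\<close> L by simp
  next
    case (2 n a b)
    then have ab: "\<And>i. i < n \<Longrightarrow> a i \<le> b i \<and> {a i..b i} \<subseteq> I" and lt: "(\<Sum>i<n. b i - a i) < e / (L + 1)"
      by auto
    have "(\<Sum>i<n. norm (\<sigma> (b i) - \<sigma> (a i))) \<le> (\<Sum>i<n. (L + 1) * (b i - a i))"
    proof (rule sum_mono)
      fix i assume "i \<in> {..<n}"
      with ab[of i] have i: "a i \<le> b i" "a i \<in> I" "b i \<in> I" by auto
      have "norm (\<sigma> (b i) - \<sigma> (a i)) \<le> L * norm (b i - a i)"
        using lipschitz_on_normD[OF assms i(3,2)] .
      also have "\<dots> \<le> (L + 1) * (b i - a i)" using i L by (intro mult_mono) auto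
      finally show "norm (\<sigma> (b i) - \<sigma> (a i)) \<le> (L + 1) * (b i - a i)" .
    qed
    also have "\<dots> = (L + 1) * (\<Sum>i<n. b i - a i)" by (simp add: sum_distrib_left)
    also have "\<dots> < (L + 1) * (e / (L + 1))" using lt L by (intro mult_strict_left_mono) auto
    also have "\<dots> = e" using L by simp
    finally show ?case .
  qed
qed

lemma unit_speed_almost_geodesic:
  assumes \<sigma>: "unit_speed_curve \<Omega> T \<sigma>" and k: "k \<ge> 0"
    and low: "\<And>s t. s \<in> {0..T} \<Longrightarrow> t \<in> {0..T} \<Longrightarrow> \<bar>s - t\<bar> - k \<le> kobayashi_dist \<Omega> (\<sigma> s) (\<sigma> t)"
  shows "almost_geodesic \<Omega> 1 k {0..T} \<sigma>"
  unfolding almost_geodesic_def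
proof (intro conjI ballI)
  show "\<sigma> ` {0..T} \<subseteq> \<Omega>" using \<sigma> by (simp add: unit_speed_curve_def)
  show "abs_continuous_on {0..T} \<sigma>"
    using \<sigma> abs_continuous_on_lipschitz by (auto simp: unit_speed_curve_def)
  obtain N where N: "finite N" "\<And>t. t \<in> {0..T} - N \<Longrightarrow> \<exists>v. (\<sigma> has_vector_derivative v) (at t) \<and>
        kobayashi_royden \<Omega> (\<sigma> t) v \<le> 1"
    using \<sigma> unfolding unit_speed_curve_def by metis
  have "AE t in lebesgue. t \<notin> N"
    using N(1) by (intro AE_not_in) (simp add: negligible_iff_null_sets[symmetric] negligible_finite)
  then show "AE t in lebesgue. t \<in> {0..T} \<longrightarrow>
      (\<exists>v. (\<sigma> has_vector_derivative v) (at t within {0..T}) \<and> kobayashi_royden \<Omega> (\<sigma> t) v \<le> 1)"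
  proof (rule AE_mp, intro AE_I2 impI)
    fix t assume "t \<notin> N" "t \<in> {0..T}"
    then obtain v where "(\<sigma> has_vector_derivative v) (at t)" "kobayashi_royden \<Omega> (\<sigma> t) v \<le> 1"
      using N(2)[of t] by auto
    then show "\<exists>v. (\<sigma> has_vector_derivative v) (at t within {0..T}) \<and> kobayashi_royden \<Omega> (\<sigma> t) v \<le> 1"
      using has_vector_derivative_at_within by blast
  qed
next
  fix s t assume st: "s \<in> {0..T}" "t \<in> {0..T}"
  then show "1 / 1 * \<bar>s - t\<bar> - k \<le> kobayashi_dist \<Omega> (\<sigma> s) (\<sigma> t)"
    using low by simp
  have "kobayashi_dist \<Omega> (\<sigma> s) (\<sigma> t) \<le> \<bar>s - t\<bar>"
    using \<sigma> st by (simp add: unit_speed_curve_def)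
  then show "kobayashi_dist \<Omega> (\<sigma> s) (\<sigma> t) \<le> 1 * \<bar>s - t\<bar> + k" using k by simp
qed

lemma unit_speed_curve_subsegment:
  assumes \<sigma>: "unit_speed_curve \<Omega> T \<sigma>" and s: "0 \<le> s1" "s1 \<le> s2" "s2 \<le> T"
  shows "unit_speed_curve \<Omega> (s2 - s1) (\<lambda>t. \<sigma> (s1 + t))"
proof -
  obtain L where L: "L-lipschitz_on {0..T} \<sigma>"
    using \<sigma> unfolding unit_speed_curve_def by metis
  obtain N where N: "finite N" "\<And>t. t \<in> {0..T} - N \<Longrightarrow> \<exists>v. (\<sigma> has_vector_derivative v) (at t) \<and>
        kobayashi_royden \<Omega> (\<sigma> t) v \<le> 1"
    using \<sigma> unfolding unit_speed_curve_def by metis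
  have img: "\<sigma> t \<in> \<Omega>" if "t \<in> {0..T}" for t
    using \<sigma> that unfolding unit_speed_curve_def by blast
  have up: "kobayashi_dist \<Omega> (\<sigma> s) (\<sigma> t) \<le> \<bar>s - t\<bar>" if "s \<in> {0..T}" "t \<in> {0..T}" for s t
    using \<sigma> that by (simp add: unit_speed_curve_def)
  have mem: "s1 + t \<in> {0..T}" if "t \<in> {0..s2 - s1}" for t using that s by auto
  show ?thesis
    unfolding unit_speed_curve_def
  proof (intro conjI ballI)
    show "0 \<le> s2 - s1" using s by simp
    show "(\<lambda>t. \<sigma> (s1 + t)) ` {0..s2 - s1} \<subseteq> \<Omega>" using img mem by blast
    show "kobayashi_dist \<Omega> (\<sigma> (s1 + s)) (\<sigma> (s1 + t)) \<le> \<bar>s - t\<bar>" if "s \<in> {0..s2 - s1}" "t \<in> {0..s2 - s1}" for s t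
      using up[OF mem[OF that(1)] mem[OF that(2)]] by simp
    have "L-lipschitz_on {0..s2 - s1} (\<lambda>t. \<sigma> (s1 + t))"
    proof (rule lipschitz_onI)
      fix x y assume "x \<in> {0..s2 - s1}" "y \<in> {0..s2 - s1}"
      then show "dist (\<sigma> (s1 + x)) (\<sigma> (s1 + y)) \<le> L * dist x y"
        using lipschitz_onD[OF L mem mem, of x y] by (simp add: dist_norm)
    qed (use L lipschitz_on_nonneg in blast)
    then show "\<exists>L. L-lipschitz_on {0..s2 - s1} (\<lambda>t. \<sigma> (s1 + t))" by blast
    show "\<exists>N. finite N \<and> (\<forall>t\<in>{0..s2 - s1} - N. \<exists>v. ((\<lambda>t. \<sigma> (s1 + t)) has_vector_derivative v) (at t) \<and>
        kobayashi_royden \<Omega> (\<sigma> (s1 + t)) v \<le> 1)"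
    proof (intro exI[of _ "(\<lambda>x. x - s1) ` N"] conjI ballI)
      fix t assume t: "t \<in> {0..s2 - s1} - (\<lambda>x. x - s1) ` N"
      then have "s1 + t \<notin> N" by (metis DiffD2 add_diff_cancel_left' imageI)
      then obtain v where v: "(\<sigma> has_vector_derivative v) (at (s1 + t))" "kobayashi_royden \<Omega> (\<sigma> (s1 + t)) v \<le> 1"
        using N(2)[of "s1 + t"] mem[of t] t by auto
      have "((\<lambda>t. s1 + t) has_vector_derivative 1) (at t)" by (auto intro!: derivative_eq_intros)
      then have "(\<sigma> \<circ> (\<lambda>t. s1 + t) has_vector_derivative 1 *\<^sub>R v) (at t)"
        using v(1) by (intro vector_diff_chain_at) auto
      then show "\<exists>v. ((\<lambda>t. \<sigma> (s1 + t)) has_vector_derivative v) (at t) \<and> kobayashi_royden \<Omega> (\<sigma> (s1 + t)) v \<le> 1"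
        using v(2) by (intro exI[of _ v]) (simp add: o_def)
    qed (use N in simp)
  qed
qed

text \<open>Hyperbolicity supplies the triangle inequality and symmetry for two times on different
  sides of \<open>S\<close>; the junction joins the exceptional set.\<close>

lemma unit_speed_curve_concat:
  assumes hyp: "hyperbolic \<Omega>" and \<sigma>: "unit_speed_curve \<Omega> S \<sigma>" and \<tau>: "unit_speed_curve \<Omega> T \<tau>"
    and eq: "\<sigma> S = \<tau> 0"
  shows "unit_speed_curve \<Omega> (S + T) (\<lambda>t. if t \<le> S then \<sigma> t else \<tau> (t - S))"
    (is "unit_speed_curve _ _ ?\<rho>")
proof -
  obtain L where L: "L-lipschitz_on {0..S} \<sigma>"
    using \<sigma> unfolding unit_speed_curve_def by metis
  obtain M where M: "M-lipschitz_on {0..T} \<tau>"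
    using \<tau> unfolding unit_speed_curve_def by metis
  obtain N where N: "finite N" "\<And>t. t \<in> {0..S} - N \<Longrightarrow> \<exists>v. (\<sigma> has_vector_derivative v) (at t) \<and>
        kobayashi_royden \<Omega> (\<sigma> t) v \<le> 1"
    using \<sigma> unfolding unit_speed_curve_def by metis
  obtain N' where N': "finite N'" "\<And>t. t \<in> {0..T} - N' \<Longrightarrow> \<exists>v. (\<tau> has_vector_derivative v) (at t) \<and>
        kobayashi_royden \<Omega> (\<tau> t) v \<le> 1"
    using \<tau> unfolding unit_speed_curve_def by metis
  have ST: "0 \<le> S" "0 \<le> T" using \<sigma> \<tau> by (auto simp: unit_speed_curve_def)
  have img\<sigma>: "\<sigma> t \<in> \<Omega>" if "t \<in> {0..S}" for t
    using \<sigma> that unfolding unit_speed_curve_def by blast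
  have img\<tau>: "\<tau> t \<in> \<Omega>" if "t \<in> {0..T}" for t
    using \<tau> that unfolding unit_speed_curve_def by blast
  have up\<sigma>: "kobayashi_dist \<Omega> (\<sigma> s) (\<sigma> t) \<le> \<bar>s - t\<bar>" if "s \<in> {0..S}" "t \<in> {0..S}" for s t
    using \<sigma> that by (simp add: unit_speed_curve_def)
  have up\<tau>: "kobayashi_dist \<Omega> (\<tau> s) (\<tau> t) \<le> \<bar>s - t\<bar>" if "s \<in> {0..T}" "t \<in> {0..T}" for s t
    using \<tau> that by (simp add: unit_speed_curve_def)
  have img: "?\<rho> t \<in> \<Omega>" if "t \<in> {0..S + T}" for t
    using that img\<sigma>[of t] img\<tau>[of "t - S"] by auto
  have mixed: "kobayashi_dist \<Omega> (\<sigma> s) (\<tau> (t - S)) \<le> t - s" if "s \<in> {0..S}" "t \<in> {S..S+T}" for s t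
  proof -
    have "kobayashi_dist \<Omega> (\<sigma> s) (\<tau> (t - S)) \<le> kobayashi_dist \<Omega> (\<sigma> s) (\<sigma> S) + kobayashi_dist \<Omega> (\<tau> 0) (\<tau> (t - S))"
      using hyperbolic_dist(3)[OF hyp, of "\<sigma> s" "\<sigma> S" "\<tau> (t - S)"] img\<sigma>[of s] img\<sigma>[of S] img\<tau>[of "t - S"] that eq ST by auto
    then show ?thesis
      using up\<sigma>[of s S] up\<tau>[of 0 "t - S"] that ST by auto
  qed
  show ?thesis
    unfolding unit_speed_curve_def
  proof (intro conjI ballI)
    show "0 \<le> S + T" using ST by simp
    show "?\<rho> ` {0..S + T} \<subseteq> \<Omega>" using img by blast
    fix s t assume st: "s \<in> {0..S + T}" "t \<in> {0..S + T}"
    consider "s \<le> S" "t \<le> S" | "s \<le> S" "t > S" | "s > S" "t \<le> S" | "s > S" "t > S" by linarith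
    then show "kobayashi_dist \<Omega> (?\<rho> s) (?\<rho> t) \<le> \<bar>s - t\<bar>"
    proof cases
      case 1
      then show ?thesis using up\<sigma>[of s t] st by auto
    next
      case 2
      then show ?thesis using mixed[of s t] st by auto
    next
      case 3
      then have "kobayashi_dist \<Omega> (?\<rho> s) (?\<rho> t) = kobayashi_dist \<Omega> (\<sigma> t) (\<tau> (s - S))"
        using hyperbolic_dist(2)[OF hyp] img\<sigma>[of t] img\<tau>[of "s - S"] st by auto
      then show ?thesis using mixed[of t s] st 3 by auto
    next
      case 4
      then show ?thesis using up\<tau>[of "s - S" "t - S"] st by auto
    qed
  next
    have "M-lipschitz_on {S..S + T} (\<lambda>t. \<tau> (t - S))"
    proof (rule lipschitz_onI)
      fix x y assume "x \<in> {S..S + T}" "y \<in> {S..S + T}"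
      then show "dist (\<tau> (x - S)) (\<tau> (y - S)) \<le> M * dist x y"
        using lipschitz_onD[OF M, of "x - S" "y - S"] by (simp add: dist_norm)
    qed (use M lipschitz_on_nonneg in blast)
    then show "\<exists>L. L-lipschitz_on {0..S + T} ?\<rho>"
      using lipschitz_on_concat_max[OF L] eq by (metis diff_self)
    show "\<exists>N. finite N \<and> (\<forall>t\<in>{0..S + T} - N. \<exists>v. (?\<rho> has_vector_derivative v) (at t) \<and>
        kobayashi_royden \<Omega> (?\<rho> t) v \<le> 1)"
    proof (intro exI[of _ "N \<union> (\<lambda>t. t + S) ` N' \<union> {S}"] conjI ballI)
      fix t assume t: "t \<in> {0..S + T} - (N \<union> (\<lambda>t. t + S) ` N' \<union> {S})"
      show "\<exists>v. (?\<rho> has_vector_derivative v) (at t) \<and> kobayashi_royden \<Omega> (?\<rho> t) v \<le> 1"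
      proof (cases "t < S")
        case True
        then obtain v where v: "(\<sigma> has_vector_derivative v) (at t)" "kobayashi_royden \<Omega> (\<sigma> t) v \<le> 1"
          using N(2)[of t] t by auto
        have "(?\<rho> has_vector_derivative v) (at t)"
          by (rule has_vector_derivative_transform_within_open[OF v(1), of "{..<S}"]) (use True in auto)
        then show ?thesis using v(2) True by auto
      next
        case False
        then have "t > S" using t by auto
        moreover have "t - S \<notin> N'" using t by (metis DiffD2 UnI1 UnI2 diff_add_cancel imageI)
        ultimately obtain v where v: "(\<tau> has_vector_derivative v) (at (t - S))" "kobayashi_royden \<Omega> (\<tau> (t - S)) v \<le> 1"
          using N'(2)[of "t - S"] t by auto
        have "((\<lambda>t. t - S) has_vector_derivative 1) (at t)" by (auto intro!: derivative_eq_intros)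
        then have "(\<tau> \<circ> (\<lambda>t. t - S) has_vector_derivative 1 *\<^sub>R v) (at t)"
          using v(1) by (intro vector_diff_chain_at) auto
        then have "((\<lambda>t. \<tau> (t - S)) has_vector_derivative v) (at t)" by (simp add: o_def)
        then have "(?\<rho> has_vector_derivative v) (at t)"
          by (rule has_vector_derivative_transform_within_open[of _ _ _ "{S<..}"]) (use \<open>t > S\<close> in auto)
        then show ?thesis using v(2) \<open>t > S\<close> by auto
      qed
    qed (use N N' in simp)
  qed
qed

lemma tanh_real_diff: "tanh (s - t) = (tanh s - tanh t) / (1 - tanh s * tanh t)" for s t :: real
  using tanh_add[of s "- t"] by simp

text \<open>The subtraction formula for \<open>tanh\<close> is exactly the quotient in
  \<open>poincare_dist\<close>, so \<open>tanh\<close> parametrises the real diameter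
  isometrically.\<close>

lemma poincare_dist_tanh:
  "poincare_dist (of_real (tanh s)) (of_real (tanh t)) = \<bar>s - t\<bar>"
proof -
  have "(complex_of_real (tanh s) - of_real (tanh t)) / (1 - cnj (of_real (tanh t)) * of_real (tanh s))
      = of_real (tanh (s - t))"
    by (simp add: tanh_real_diff mult.commute)
  then have "poincare_dist (of_real (tanh s)) (of_real (tanh t)) = artanh \<bar>tanh (s - t)\<bar>"
    by (simp add: poincare_dist_def)
  also have "\<bar>tanh (s - t)\<bar> = tanh \<bar>s - t\<bar>" by (simp add: tanh_real_abs)
  finally show ?thesis by (simp only: artanh_tanh_real)
qed

lemma tanh_in_ball: "complex_of_real (tanh t) \<in> ball 0 1" for t :: real
  using tanh_real_bounds[of t] by (simp add: abs_less_iff)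

lemma kobayashi_royden_le:
  assumes "analytic_disc \<Omega> f" "f 0 = z" "c *s disc_deriv f 0 = v"
  shows "kobayashi_royden \<Omega> z v \<le> cmod c"
  unfolding kobayashi_royden_def disc_deriv_def[symmetric]
  by (rule cInf_lower) (use assms in \<open>auto intro!: bdd_belowI[of _ 0]\<close>)

lemma disc_deriv_compose:
  assumes f: "analytic_disc \<Omega> f" "\<phi> \<zeta> \<in> ball 0 1" and \<phi>: "(\<phi> has_field_derivative c) (at \<zeta>)"
  shows "disc_deriv (f \<circ> \<phi>) \<zeta> = c *s disc_deriv f (\<phi> \<zeta>)"
proof (rule disc_deriv_eqI)
  have "(\<phi> has_derivative (\<lambda>h. c * h)) (at \<zeta>)"
    using \<phi> by (simp add: has_field_derivative_def)
  then have "(f \<circ> \<phi> has_derivative (\<lambda>h. h *s disc_deriv f (\<phi> \<zeta>)) \<circ> (\<lambda>h. c * h)) (at \<zeta>)"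
    using analytic_disc_has_derivative[OF f] by (rule diff_chain_at)
  moreover have "(\<lambda>h. h *s disc_deriv f (\<phi> \<zeta>)) \<circ> (\<lambda>h. c * h) = (\<lambda>h. h *s (c *s disc_deriv f (\<phi> \<zeta>)))"
    by (auto simp: fun_eq_iff vec_eq_iff)
  ultimately show "(f \<circ> \<phi> has_derivative (\<lambda>h. h *s (c *s disc_deriv f (\<phi> \<zeta>)))) (at \<zeta>)" by simp
qed

text \<open>
  The curve \<open>tanh\<close> traverses the real diameter of the disc with unit Poincare speed; the derivative
  is realised by precomposing \<open>g\<close> with the automorphism of the disc that maps 0 to \<open>tanh t\<close>.
\<close>

lemma unit_speed_curve_tanh:
  assumes g: "analytic_disc \<Omega> g" and "0 \<le> T"
  shows "unit_speed_curve \<Omega> T (\<lambda>t. g (of_real (tanh t)))"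
proof -
  define u where "u t = complex_of_real (tanh t)" for t
  \<comment> \<open>The factor \<open>1 - u t ^ 2\<close> is at once the derivative of
    \<open>tanh\<close> at \<open>t\<close> and the derivative at 0 of the automorphism sending 0 to
    \<open>u t\<close>; this coincidence yields the Royden bound 1.\<close>
  define v where "v t = (1 - u t ^ 2) *s disc_deriv g (u t)" for t
  have u: "u t \<in> ball 0 1" for t unfolding u_def by (rule tanh_in_ball)
  have der: "((\<lambda>t. g (u t)) has_vector_derivative v t) (at t)" for t
  proof -
    have "(tanh has_real_derivative (1 - tanh t ^ 2)) (at t)"
      by (auto intro!: derivative_eq_intros)
    then have "(u has_vector_derivative (of_real (1 - tanh t ^ 2))) (at t)"
      unfolding u_def by (intro has_vector_derivative_of_real) (simp add: has_real_derivative_iff_has_vector_derivative)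
    then have "(g \<circ> u has_derivative (\<lambda>h. h *s disc_deriv g (u t)) \<circ> (\<lambda>h. h *\<^sub>R of_real (1 - tanh t ^ 2))) (at t)"
      unfolding has_vector_derivative_def
      by (rule diff_chain_at) (rule analytic_disc_has_derivative[OF g u])
    moreover have "(\<lambda>h. h *s disc_deriv g (u t)) \<circ> (\<lambda>h. h *\<^sub>R of_real (1 - tanh t ^ 2)) = (\<lambda>h. h *\<^sub>R v t)"
      by (auto simp: fun_eq_iff vec_eq_iff v_def u_def algebra_simps)
    ultimately show ?thesis by (simp add: has_vector_derivative_def o_def)
  qed
  have roy: "kobayashi_royden \<Omega> (g (u t)) (v t) \<le> 1" for t
  proof -
    let ?M = "Moebius_function 0 (- u t)"
    have u1: "cmod (- u t) < 1" using u[of t] by simp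
    have M: "analytic_disc \<Omega> (g \<circ> ?M)"
      using Moebius_function_norm_lt_1[OF u1]
      by (intro analytic_disc_compose[OF g] Moebius_function_holomorphic[OF u1]) auto
    have M0: "?M 0 = u t" by (simp add: Moebius_function_simple)
    have "(?M has_field_derivative (1 - u t ^ 2)) (at 0)"
      unfolding Moebius_function_simple[abs_def]
      by (rule derivative_eq_intros refl | simp add: power2_eq_square u_def)+
    then have "disc_deriv (g \<circ> ?M) 0 = v t"
      using disc_deriv_compose[OF g, of ?M 0 "1 - u t ^ 2"] u M0 by (simp add: v_def)
    then show ?thesis
      using kobayashi_royden_le[OF M, of "g (u t)" 1 "v t"] M0 by simp
  qed
  \<comment> \<open>Continuity bounds \<open>v\<close> on the compact interval, and that bound is
    the Lipschitz constant.\<close>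
  have cont: "continuous_on UNIV v"
  proof -
    have "(\<lambda>\<zeta>. disc_deriv g \<zeta> $ i) holomorphic_on ball 0 1" for i
      using g by (auto simp: disc_deriv_def analytic_disc_def intro!: holomorphic_deriv)
    then have "continuous_on (ball 0 1) (\<lambda>\<zeta>. disc_deriv g \<zeta> $ i)" for i
      using holomorphic_on_imp_continuous_on by blast
    moreover have "continuous_on UNIV u" unfolding u_def by (intro continuous_intros) auto
    moreover have "u ` UNIV \<subseteq> ball 0 1" using u by (rule image_subsetI)
    ultimately have comp: "continuous_on UNIV (\<lambda>t. disc_deriv g (u t) $ i)" for i
      by (rule continuous_on_compose2)
    have "continuous_on UNIV (\<lambda>t. v t $ i)" for i
      unfolding v_def vector_smult_component
      by (intro continuous_on_mult continuous_on_diff continuous_on_const continuous_on_power comp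
          \<open>continuous_on UNIV u\<close>)
    then have "continuous_on UNIV (\<lambda>t. \<chi> i. v t $ i)"
      by (rule continuous_on_vec_lambda)
    then show ?thesis by simp
  qed
  have "compact (v ` {0..T})"
    using cont continuous_on_subset by (intro compact_continuous_image) auto
  then obtain B where B: "B > 0" "\<And>t. t \<in> {0..T} \<Longrightarrow> norm (v t) \<le> B"
    using compact_imp_bounded bounded_pos by (metis imageI)
  have "B-lipschitz_on {0..T} (\<lambda>t. g (u t))"
  proof (rule bounded_derivative_imp_lipschitz)
    fix t assume t: "t \<in> {0..T}"
    show "((\<lambda>t. g (u t)) has_derivative (\<lambda>h. h *\<^sub>R v t)) (at t within {0..T})"
      using der[of t] has_vector_derivative_at_within unfolding has_vector_derivative_def[symmetric] by blast
    show "onorm (\<lambda>h. h *\<^sub>R v t) \<le> B"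
      using B(2)[OF t] by (intro onorm_le) (simp add: mult.commute[of B] mult_left_mono)
  qed (use B in auto)
  then have lip: "\<exists>B. B-lipschitz_on {0..T} (\<lambda>t. g (u t))" ..
  have dist: "kobayashi_dist \<Omega> (g (u s)) (g (u t)) \<le> \<bar>s - t\<bar>" for s t
    using kobayashi_dist_disc_le[OF g u u, of s t] poincare_dist_tanh[of s t] by (simp add: u_def)
  have "g (u t) \<in> \<Omega>" for t
    using g u[of t] unfolding analytic_disc_def by (metis imageI subsetD)
  moreover have "\<exists>N. finite N \<and> (\<forall>t\<in>{0..T} - N. \<exists>v. ((\<lambda>t. g (u t)) has_vector_derivative v) (at t) \<and>
      kobayashi_royden \<Omega> (g (u t)) v \<le> 1)"
    using der roy by (metis finite.emptyI)
  ultimately show ?thesis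
    unfolding unit_speed_curve_def u_def[symmetric]
    using \<open>0 \<le> T\<close> lip dist by (intro conjI ballI image_subsetI)
qed

lemma tanh_artanh_real:
  assumes "\<bar>x\<bar> < (1::real)"
  shows "tanh (artanh x) = x"
proof -
  have pos: "0 < (1 + x) / (1 - x)" using assms by (auto simp: abs_less_iff)
  have "exp (- (2 * artanh x)) = inverse ((1 + x) / (1 - x))"
    using pos by (simp add: artanh_def exp_minus)
  then have "exp (- (2 * artanh x)) = (1 - x) / (1 + x)" by simp
  moreover have "(1 - (1 - x) / (1 + x)) / (1 + (1 - x) / (1 + x)) = x"
    using assms by (simp add: field_simps abs_less_iff)
  ultimately show ?thesis
    by (simp add: tanh_real_altdef)
qed

text \<open>An automorphism of the disc moves \<open>a\<close> to 0 and \<open>b\<close> to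
  \<open>cmod w\<close> on the real diameter, where the \<open>tanh\<close> curve is available;
  \<open>\<phi>\<close> is the inverse of this normalisation.\<close>

lemma unit_speed_curve_disc:
  assumes f: "analytic_disc \<Omega> f" and a: "a \<in> ball 0 1" and b: "b \<in> ball 0 1"
  obtains \<sigma> where "unit_speed_curve \<Omega> (poincare_dist a b) \<sigma>" "\<sigma> 0 = f a" "\<sigma> (poincare_dist a b) = f b"
proof -
  have a1: "cmod (- a) < 1" using a by simp
  define w where "w = Moebius_function 0 a b"
  \<comment> \<open>\<open>cis (Arg w)\<close> lies on the unit circle even for
    \<open>w = 0\<close>, that is, for \<open>a = b\<close>.\<close>
  define e where "e = cis (Arg w)"
  have w: "w = of_real (cmod w) * e"
    using rcis_cmod_Arg[of w] by (simp add: rcis_def e_def)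
  have w1: "cmod w < 1" using Moebius_function_norm_lt_1[of a b] a b by (simp add: w_def)
  define \<phi> where "\<phi> \<zeta> = Moebius_function 0 (- a) (\<zeta> * e)" for \<zeta>
  have e1: "cmod e = 1" by (simp add: e_def)
  have "(Moebius_function 0 (- a) \<circ> (\<lambda>\<zeta>. \<zeta> * e)) holomorphic_on ball 0 1"
    by (rule holomorphic_on_compose_gen[OF _ Moebius_function_holomorphic[OF a1]])
       (auto intro!: holomorphic_intros simp: norm_mult e1)
  then have "\<phi> holomorphic_on ball 0 1" by (simp add: \<phi>_def[abs_def] o_def)
  moreover have "\<phi> ` ball 0 1 \<subseteq> ball 0 1"
    using Moebius_function_norm_lt_1[OF a1] by (auto simp: \<phi>_def norm_mult e1)
  ultimately have g: "analytic_disc \<Omega> (f \<circ> \<phi>)" by (rule analytic_disc_compose[OF f])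
  have T: "poincare_dist a b = artanh (cmod w)"
    using poincare_dist_commute[of a b] poincare_dist_Moebius[of b a] by (simp add: w_def)
  have "tanh (poincare_dist a b) = cmod w"
    using w1 by (simp add: T tanh_artanh_real)
  moreover have "\<phi> (of_real (cmod w)) = b"
    unfolding \<phi>_def w[symmetric] unfolding w_def
    using a b by (intro Moebius_function_compose) auto
  moreover have "\<phi> 0 = a" by (simp add: \<phi>_def Moebius_function_simple)
  ultimately show thesis
    using that[OF unit_speed_curve_tanh[OF g]] poincare_dist_nonneg[OF a b] by simp
qed

text \<open>Each disc contributes an arc of duration \<open>poincare_dist (a j) (b j)\<close>, so
  the concatenation takes exactly the time \<open>L\<close>.\<close>

lemma unit_speed_curve_chain:
  assumes hyp: "hyperbolic \<Omega>" and z: "z \<in> \<Omega>" and L: "L \<in> chain_lengths \<Omega> z w"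
  obtains \<sigma> where "unit_speed_curve \<Omega> L \<sigma>" "\<sigma> 0 = z" "\<sigma> L = w"
proof -
  have *: "\<exists>\<sigma>. unit_speed_curve \<Omega> (\<Sum>j<n. poincare_dist (a j) (b j)) \<sigma> \<and> \<sigma> 0 = p 0 \<and>
      \<sigma> (\<Sum>j<n. poincare_dist (a j) (b j)) = p n"
    if "p 0 = z" "\<forall>j<n. analytic_disc \<Omega> (f j) \<and> a j \<in> ball 0 1 \<and> b j \<in> ball 0 1 \<and>
            f j (a j) = p j \<and> f j (b j) = p (Suc j)" for n a b f p
    using that(2)
  proof (induction n)
    case 0
    \<comment> \<open>The time interval is a single point, which is put into the exceptional
      set.\<close>
    have "unit_speed_curve \<Omega> 0 (\<lambda>_. z)"
      unfolding unit_speed_curve_def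
      using z hyperbolic_dist(1)[OF hyp z] by (auto intro!: exI[of _ "{0::real}"] exI[of _ "0::real"])
    then show ?case using that(1) by auto
  next
    case (Suc n)
    let ?S = "\<Sum>j<n. poincare_dist (a j) (b j)" and ?T = "poincare_dist (a n) (b n)"
    obtain \<sigma> where \<sigma>: "unit_speed_curve \<Omega> ?S \<sigma>" "\<sigma> 0 = p 0" "\<sigma> ?S = p n"
      using Suc by auto
    obtain \<tau> where \<tau>: "unit_speed_curve \<Omega> ?T \<tau>" "\<tau> 0 = p n" "\<tau> ?T = p (Suc n)"
      using unit_speed_curve_disc[of \<Omega> "f n" "a n" "b n"] Suc.prems by (metis lessI)
    have "0 \<le> ?S" "0 \<le> ?T" using \<sigma> \<tau> by (auto simp: unit_speed_curve_def)
    moreover have "unit_speed_curve \<Omega> (?S + ?T) (\<lambda>t. if t \<le> ?S then \<sigma> t else \<tau> (t - ?S))"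
      using \<sigma> \<tau> by (intro unit_speed_curve_concat[OF hyp]) auto
    ultimately show ?case
      using \<sigma> \<tau> by (intro exI[of _ "\<lambda>t. if t \<le> ?S then \<sigma> t else \<tau> (t - ?S)"]) auto
  qed
  obtain n a b f p where chain: "L = (\<Sum>j<n. poincare_dist (a j) (b j))" "p 0 = z" "p n = w"
    "\<forall>j<n. analytic_disc \<Omega> (f j) \<and> a j \<in> ball 0 1 \<and> b j \<in> ball 0 1 \<and>
            f j (a j) = p j \<and> f j (b j) = p (Suc j)"
    using L unfolding chain_lengths_def mem_Collect_eq by (elim exE conjE) (rule that)
  obtain \<sigma> where "unit_speed_curve \<Omega> L \<sigma>" "\<sigma> 0 = p 0" "\<sigma> L = p n"
    using *[OF chain(2,4)] unfolding chain(1) by (elim exE conjE)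
  then show thesis using that chain(2,3) by simp
qed

text \<open>A chain within \<open>k\<close> of the infimum gives a curve whose total time exceeds
  the distance of its end points by less than \<open>k\<close>. The outer pieces span no more
  distance than the time they take, so the defect of a middle piece is at most the total
  defect.\<close>

lemma almost_minimal_curve_exists:
  assumes dom: "domain \<Omega>" and hyp: "hyperbolic \<Omega>" and "z \<in> \<Omega>" "w \<in> \<Omega>" and "k > 0"
  obtains T \<sigma> where "unit_speed_curve \<Omega> T \<sigma>" "\<sigma> 0 = z" "\<sigma> T = w"
    "\<And>s t. s \<in> {0..T} \<Longrightarrow> t \<in> {0..T} \<Longrightarrow> \<bar>s - t\<bar> - k \<le> kobayashi_dist \<Omega> (\<sigma> s) (\<sigma> t)"
proof -
  have "Inf (chain_lengths \<Omega> z w) < kobayashi_dist \<Omega> z w + k"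
    using \<open>k > 0\<close> by (simp add: kobayashi_dist_eq_Inf)
  then obtain T where T: "T \<in> chain_lengths \<Omega> z w" "T < kobayashi_dist \<Omega> z w + k"
    using cInf_lessD[OF chain_lengths_nonempty[OF dom \<open>z \<in> \<Omega>\<close> \<open>w \<in> \<Omega>\<close>]] by metis
  obtain \<sigma> where \<sigma>: "unit_speed_curve \<Omega> T \<sigma>" "\<sigma> 0 = z" "\<sigma> T = w"
    using unit_speed_curve_chain[OF hyp \<open>z \<in> \<Omega>\<close> T(1)] .
  have T0: "0 \<le> T" using \<sigma> by (simp add: unit_speed_curve_def)
  have img: "\<sigma> t \<in> \<Omega>" if "t \<in> {0..T}" for t
    using \<sigma>(1) that unfolding unit_speed_curve_def by blast
  have up: "kobayashi_dist \<Omega> (\<sigma> s) (\<sigma> t) \<le> \<bar>s - t\<bar>" if "s \<in> {0..T}" "t \<in> {0..T}" for s t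
    using \<sigma>(1) that by (simp add: unit_speed_curve_def)
  have le: "t - s - k \<le> kobayashi_dist \<Omega> (\<sigma> s) (\<sigma> t)" if "s \<in> {0..T}" "t \<in> {0..T}" "s \<le> t" for s t
  proof -
    have "kobayashi_dist \<Omega> z w \<le> kobayashi_dist \<Omega> (\<sigma> 0) (\<sigma> s) + kobayashi_dist \<Omega> (\<sigma> s) (\<sigma> T)"
      using hyperbolic_dist(3)[OF hyp, of "\<sigma> 0" "\<sigma> s" "\<sigma> T"] img[of 0] img[of s] img[of T] that T0 \<sigma> by auto
    also have "kobayashi_dist \<Omega> (\<sigma> s) (\<sigma> T) \<le> kobayashi_dist \<Omega> (\<sigma> s) (\<sigma> t) + kobayashi_dist \<Omega> (\<sigma> t) (\<sigma> T)"
      using hyperbolic_dist(3)[OF hyp, of "\<sigma> s" "\<sigma> t" "\<sigma> T"] img[of t] img[of s] img[of T] that T0 by auto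
    finally show ?thesis
      using up[of 0 s] up[of t T] that T0 T(2) by auto
  qed
  have "\<bar>s - t\<bar> - k \<le> kobayashi_dist \<Omega> (\<sigma> s) (\<sigma> t)" if "s \<in> {0..T}" "t \<in> {0..T}" for s t
    using le[of s t] le[of t s] that hyperbolic_dist(2)[OF hyp img img, of s t] by linarith
  then show thesis using that \<sigma> by blast
qed

section \<open>Invariance under biholomorphisms\<close>

lemma holomorphic_map_onD:
  assumes "holomorphic_map_on \<Omega> G" "z \<in> \<Omega>"
  obtains D where "(G has_derivative D) (at z)" "\<And>c v. D (c *s v) = c *s D v"
  using assms unfolding holomorphic_map_on_def by blast

lemma disc_holomorphic_map:
  assumes G: "(G has_derivative D) (at (f \<zeta>))" "\<And>c v. D (c *s v) = c *s D v"
    and f: "(f has_derivative (\<lambda>h. h *s v)) (at \<zeta>)"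
  shows "((\<lambda>\<zeta>. G (f \<zeta>)) has_derivative (\<lambda>h. h *s D v)) (at \<zeta>)"
  using diff_chain_at[OF f G(1)] by (simp add: o_def G(2))

lemma analytic_disc_holomorphic_map:
  assumes G: "holomorphic_map_on \<Omega> G" "G ` \<Omega> \<subseteq> \<Omega>'" and f: "analytic_disc \<Omega> f"
  shows "analytic_disc \<Omega>' (G \<circ> f)"
  unfolding analytic_disc_iff
proof (intro conjI ballI)
  have f\<Omega>: "f ` ball 0 1 \<subseteq> \<Omega>" using f by (simp add: analytic_disc_def)
  then show "(G \<circ> f) ` ball 0 1 \<subseteq> \<Omega>'" using G(2) by (metis image_comp image_mono subset_trans)
  fix \<zeta> :: complex assume \<zeta>: "\<zeta> \<in> ball 0 1"
  then have "f \<zeta> \<in> \<Omega>" using f\<Omega> by (metis imageI subsetD)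
  then obtain D where "(G has_derivative D) (at (f \<zeta>))" "\<And>c v. D (c *s v) = c *s D v"
    using holomorphic_map_onD[OF G(1)] by metis
  then have "((\<lambda>\<zeta>. G (f \<zeta>)) has_derivative (\<lambda>h. h *s D (disc_deriv f \<zeta>))) (at \<zeta>)"
    using analytic_disc_has_derivative[OF f \<zeta>] by (rule disc_holomorphic_map)
  then show "\<exists>v. (G \<circ> f has_derivative (\<lambda>h. h *s v)) (at \<zeta>)" unfolding o_def ..
qed

text \<open>Composition with \<open>G\<close> turns competitors for \<open>v\<close> into
  competitors for \<open>D v\<close> with the same \<open>c\<close>. Comparing real infima also
  requires some competitor for \<open>v\<close>, supplied by a small affine disc.\<close>

lemma kobayashi_royden_holomorphic_map_le:
  assumes "open \<Omega>" and G: "holomorphic_map_on \<Omega> G" "G ` \<Omega> \<subseteq> \<Omega>'" and z: "z \<in> \<Omega>"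
    and D: "(G has_derivative D) (at z)" "\<And>c v. D (c *s v) = c *s D v"
  shows "kobayashi_royden \<Omega>' (G z) (D v) \<le> kobayashi_royden \<Omega> z v"
  unfolding kobayashi_royden_def disc_deriv_def[symmetric]
proof (rule cInf_superset_mono)
  obtain r where r: "r > 0" "ball z r \<subseteq> \<Omega>" using \<open>open \<Omega>\<close> z open_contains_ball by metis
  \<comment> \<open>The summand 1 keeps the scaling meaningful for \<open>v = 0\<close>.\<close>
  define w where "w = of_real (r / (norm v + 1)) *s v"
  have pos: "norm v + 1 > 0" using norm_ge_zero[of v] by linarith
  have "norm w = norm (complex_of_real (r / (norm v + 1))) * norm v"
    unfolding w_def by (rule norm_vector_scalar_mult)
  also have "\<dots> = r * (norm v / (norm v + 1))" using r pos by (simp add: norm_divide)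
  also have "\<dots> < r * 1" using r pos by (intro mult_strict_left_mono) auto
  finally have nw: "norm w < r" by simp
  have disc: "analytic_disc \<Omega> (\<lambda>\<zeta>. z + \<zeta> *s w)"
  proof (rule analytic_disc_affine)
    fix \<zeta> :: complex assume "\<zeta> \<in> ball 0 1"
    then have "cmod \<zeta> * norm w \<le> 1 * norm w" by (intro mult_right_mono) auto
    then have "z + \<zeta> *s w \<in> ball z r" using nw by (simp add: dist_norm norm_vector_scalar_mult)
    then show "z + \<zeta> *s w \<in> \<Omega>" using r by blast
  qed
  have "((\<lambda>\<zeta>. z + \<zeta> *s w) has_derivative (\<lambda>h. h *s w)) (at 0)"
    unfolding has_derivative_vec_iff_field by (auto intro!: derivative_eq_intros)
  then have "disc_deriv (\<lambda>\<zeta>. z + \<zeta> *s w) 0 = w" by (rule disc_deriv_eqI)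
  moreover have "of_real ((norm v + 1) / r) *s w = v"
    using r pos unfolding w_def vector_smult_assoc of_real_mult[symmetric] by simp
  ultimately have "cmod (of_real ((norm v + 1) / r)) \<in> {cmod c |c f. analytic_disc \<Omega> f \<and> f 0 = z \<and> c *s disc_deriv f 0 = v}"
    using disc by (intro CollectI exI[of _ "\<lambda>\<zeta>. z + \<zeta> *s w"] exI conjI refl) auto
  then show "{cmod c |c f. analytic_disc \<Omega> f \<and> f 0 = z \<and> c *s disc_deriv f 0 = v} \<noteq> {}" by (metis emptyE)
  show "bdd_below {cmod c |c f. analytic_disc \<Omega>' f \<and> f 0 = G z \<and> c *s disc_deriv f 0 = D v}"
    by (intro bdd_belowI[of _ 0]) auto
  show "{cmod c |c f. analytic_disc \<Omega> f \<and> f 0 = z \<and> c *s disc_deriv f 0 = v}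
    \<subseteq> {cmod c |c f. analytic_disc \<Omega>' f \<and> f 0 = G z \<and> c *s disc_deriv f 0 = D v}"
  proof (intro subsetI, elim CollectE exE conjE, intro CollectI exI conjI)
    fix x c f assume "x = cmod c" and f: "analytic_disc \<Omega> f" "f 0 = z" "c *s disc_deriv f 0 = v"
    show "x = cmod c" by fact
    show "analytic_disc \<Omega>' (G \<circ> f)" by (rule analytic_disc_holomorphic_map[OF G f(1)])
    show "(G \<circ> f) 0 = G z" using f by simp
    have "((\<lambda>\<zeta>. G (f \<zeta>)) has_derivative (\<lambda>h. h *s D (disc_deriv f 0))) (at 0)"
      using D(1) by (intro disc_holomorphic_map[OF _ D(2) analytic_disc_has_derivative[OF f(1)]]) (simp_all add: f)
    then have "disc_deriv (\<lambda>\<zeta>. G (f \<zeta>)) 0 = D (disc_deriv f 0)" by (rule disc_deriv_eqI)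
    then show "c *s disc_deriv (G \<circ> f) 0 = D v" using f(3) D(2) by (simp add: o_def) metis
  qed
qed

lemma chain_lengths_holomorphic_map:
  assumes G: "holomorphic_map_on \<Omega> G" "G ` \<Omega> \<subseteq> \<Omega>'"
  shows "chain_lengths \<Omega> z w \<subseteq> chain_lengths \<Omega>' (G z) (G w)"
proof
  fix L assume "L \<in> chain_lengths \<Omega> z w"
  then obtain n a b f p where *: "L = (\<Sum>j<n. poincare_dist (a j) (b j))" "p 0 = z" "p n = w"
    "\<forall>j<n. analytic_disc \<Omega> (f j) \<and> a j \<in> ball 0 1 \<and> b j \<in> ball 0 1 \<and>
            f j (a j) = p j \<and> f j (b j) = p (Suc j)"
    unfolding chain_lengths_def mem_Collect_eq by (elim exE conjE) (rule that)
  show "L \<in> chain_lengths \<Omega>' (G z) (G w)"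
    unfolding chain_lengths_def mem_Collect_eq
  proof (intro exI conjI)
    show "(G \<circ> p) 0 = G z" "(G \<circ> p) n = G w" using * by simp_all
    show "\<forall>j<n. analytic_disc \<Omega>' (G \<circ> f j) \<and> a j \<in> ball 0 1 \<and> b j \<in> ball 0 1 \<and>
            (G \<circ> f j) (a j) = (G \<circ> p) j \<and> (G \<circ> f j) (b j) = (G \<circ> p) (Suc j)"
      using *(4) analytic_disc_holomorphic_map[OF G] by simp
  qed (rule *(1))
qed

text \<open>\<open>G\<close> and \<open>H\<close> map chains to chains with the same parameters, so
  both distances are infima of one set of lengths.\<close>

lemma kobayashi_dist_biholomorphic:
  assumes G: "holomorphic_map_on \<Omega> G" "G ` \<Omega> \<subseteq> \<Omega>'"
    and H: "holomorphic_map_on \<Omega>' H" "H ` \<Omega>' \<subseteq> \<Omega>"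
    and inv: "\<And>z. z \<in> \<Omega> \<Longrightarrow> H (G z) = z" and "z \<in> \<Omega>" "w \<in> \<Omega>"
  shows "kobayashi_dist \<Omega>' (G z) (G w) = kobayashi_dist \<Omega> z w"
  using chain_lengths_holomorphic_map[OF G, of z w] chain_lengths_holomorphic_map[OF H, of "G z" "G w"] assms(5-7)
  by (simp add: kobayashi_dist_eq_Inf)

lemma holomorphic_map_on_continuous_on:
  assumes "holomorphic_map_on \<Omega> G"
  shows "continuous_on \<Omega> G"
proof (rule continuous_at_imp_continuous_on, rule ballI)
  fix z assume "z \<in> \<Omega>"
  then obtain D where "(G has_derivative D) (at z)" using holomorphic_map_onD[OF assms] by metis
  then show "isCont G z" by (rule has_derivative_continuous)
qed

text \<open>Cauchy's inequality for each component of \<open>G\<close> along the affine disc of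
  radius \<open>r\<close> in the direction of \<open>v\<close>. The factor \<open>CARD('d)\<close>
  comes from bounding the norm by the sum of the moduli of the components.\<close>

lemma holomorphic_map_derivative_bound:
  assumes G: "holomorphic_map_on \<Omega> G" and "r > 0" and sub: "cball z r \<subseteq> \<Omega>"
    and B: "\<And>x. x \<in> cball z r \<Longrightarrow> norm (G x) \<le> B"
    and D: "(G has_derivative D) (at z)" "\<And>c v. D (c *s v) = c *s D v"
  shows "norm (D v) \<le> of_nat CARD('d) * B / r * norm (v :: complex ^ 'd)"
proof (cases "v = 0")
  case True
  then show ?thesis using D(2)[of 0 v] by simp
next
  case False
  define w where "w = of_real (r / norm v) *s v"
  have "norm w = norm (complex_of_real (r / norm v)) * norm v"
    unfolding w_def by (rule norm_vector_scalar_mult)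
  then have nw: "norm w = r" using False \<open>r > 0\<close> by (simp add: norm_divide)
  define f where "f \<zeta> = z + \<zeta> *s w" for \<zeta>
  have f: "f \<zeta> \<in> cball z r" if "\<zeta> \<in> cball 0 1" for \<zeta>
    using that nw \<open>r > 0\<close> by (simp add: f_def dist_norm norm_vector_scalar_mult)
  have fd: "(f has_derivative (\<lambda>h. h *s w)) (at \<zeta>)" for \<zeta>
    unfolding has_derivative_vec_iff_field f_def by (auto intro!: derivative_eq_intros)
  have der: "\<exists>v. ((\<lambda>\<zeta>. G (f \<zeta>)) has_derivative (\<lambda>h. h *s v)) (at \<zeta>)" if "\<zeta> \<in> cball 0 1" for \<zeta>
  proof -
    have "f \<zeta> \<in> \<Omega>" using f[OF that] sub by blast
    then obtain D where "(G has_derivative D) (at (f \<zeta>))" "\<And>c v. D (c *s v) = c *s D v"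
      using holomorphic_map_onD[OF G] by metis
    then show ?thesis using disc_holomorphic_map[OF _ _ fd] by metis
  qed
  have comp: "cmod (D w $ i) \<le> B" for i
  proof -
    let ?g = "\<lambda>\<zeta>. G (f \<zeta>) $ i"
    have g: "\<exists>c. (?g has_field_derivative c) (at \<zeta>)" if "\<zeta> \<in> cball 0 1" for \<zeta>
      using der[OF that] unfolding has_derivative_vec_iff_field by metis
    have hol: "?g holomorphic_on ball 0 1"
      using g by (auto simp: holomorphic_on_open)
    have cont: "continuous_on (cball 0 1) ?g"
      using g by (intro continuous_at_imp_continuous_on ballI) (metis DERIV_isCont)
    have bd: "cmod (?g \<zeta>) \<le> B" if "cmod (0 - \<zeta>) = 1" for \<zeta>
    proof -
      have "norm (G (f \<zeta>)) \<le> B" using that by (intro B f) simp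
      then show ?thesis using Finite_Cartesian_Product.norm_nth_le order_trans by blast
    qed
    have "((\<lambda>\<zeta>. G (f \<zeta>)) has_derivative (\<lambda>h. h *s D w)) (at 0)"
      using D(1) by (intro disc_holomorphic_map[OF _ D(2) fd]) (simp add: f_def)
    then have "deriv ?g 0 = D w $ i"
      unfolding has_derivative_vec_iff_field using DERIV_imp_deriv by blast
    moreover have "cmod ((deriv ^^ 1) ?g 0) \<le> fact 1 * B / 1 ^ 1"
      by (rule Cauchy_inequality[OF hol cont _ bd]) auto
    ultimately show ?thesis by simp
  qed
  have "norm (D w) \<le> (\<Sum>i\<in>UNIV. norm (D w $ i))"
    unfolding norm_vec_def by (rule L2_set_le_sum) simp
  also have "\<dots> \<le> (\<Sum>i\<in>(UNIV::'d set). B)" by (intro sum_mono comp)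
  finally have Dw: "norm (D w) \<le> of_nat CARD('d) * B" by simp
  have v: "v = of_real (norm v / r) *s w"
    using False \<open>r > 0\<close> unfolding w_def vector_smult_assoc of_real_mult[symmetric] by simp
  have "D v = of_real (norm v / r) *s D w"
    by (subst v) (rule D(2))
  then have "norm (D v) = norm (complex_of_real (norm v / r)) * norm (D w)"
    by (simp only: norm_vector_scalar_mult)
  also have "\<dots> = norm v / r * norm (D w)"
    using \<open>r > 0\<close> by (simp add: norm_divide)
  also have "\<dots> \<le> norm v / r * (of_nat CARD('d) * B)"
    using Dw \<open>r > 0\<close> by (intro mult_left_mono) auto
  finally show ?thesis by (simp add: mult.commute mult.left_commute)
qed

text \<open>Pointwise differentiability says nothing about how the derivative varies. Cauchy's bound
  makes the derivatives uniformly bounded near \<open>C\<close>, and convexity of balls turns this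
  into a Lipschitz estimate.\<close>

lemma holomorphic_map_uniformly_lipschitz:
  assumes "open \<Omega>" and G: "holomorphic_map_on \<Omega> (G :: complex ^ 'd \<Rightarrow> complex ^ 'd)" and C: "compact C" "C \<subseteq> \<Omega>"
  obtains r L where "r > 0" "L \<ge> 0"
    "\<And>x y. x \<in> C \<Longrightarrow> dist x y < r \<Longrightarrow> norm (G y - G x) \<le> L * norm (y - x)"
proof -
  obtain e where e: "e > 0" "(\<Union>x\<in>C. cball x e) \<subseteq> \<Omega>"
    using compact_subset_open_imp_cball_epsilon_subset[OF C(1) \<open>open \<Omega>\<close> C(2)] .
  define N where "N = {x + y |x y. x \<in> C \<and> y \<in> cball 0 e}"
  have ball_N: "y \<in> N" if "x \<in> C" "dist x y \<le> e" for x y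
    unfolding N_def using that
    by (intro CollectI exI[of _ x] exI[of _ "y - x"]) (auto simp: dist_norm norm_minus_commute)
  have "compact N" unfolding N_def by (rule compact_sums[OF C(1)]) simp
  moreover have N\<Omega>: "N \<subseteq> \<Omega>"
  proof
    fix u assume "u \<in> N"
    then obtain x y where "u = x + y" "x \<in> C" "norm y \<le> e" by (auto simp: N_def)
    then have "u \<in> cball x e" by (simp add: dist_norm)
    then show "u \<in> \<Omega>" using e(2) \<open>x \<in> C\<close> by blast
  qed
  ultimately have "compact (G ` N)"
    using holomorphic_map_on_continuous_on[OF G] continuous_on_subset by (metis compact_continuous_image)
  then obtain B where B: "B > 0" "\<And>x. x \<in> N \<Longrightarrow> norm (G x) \<le> B"
    using compact_imp_bounded bounded_pos by (metis imageI)
  \<comment> \<open>The radius \<open>e\<close> is spent in two halves: one for moving from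
    \<open>x\<close> to \<open>z\<close>, one for the ball around \<open>z\<close> on which Cauchy's
    bound is applied.\<close>
  define L where "L = of_nat CARD('d) * B / (e / 2)"
  have L: "L \<ge> 0" using B e by (simp add: L_def)
  have "norm (G y - G x) \<le> L * norm (y - x)" if x: "x \<in> C" and xy: "dist x y < e / 2" for x y
  proof -
    define D where "D z = (SOME D. (G has_derivative D) (at z) \<and> (\<forall>c v. D (c *s v) = c *s D v))" for z
    have D: "(G has_derivative D z) (at z) \<and> (\<forall>c v. D z (c *s v) = c *s D z v)" if "z \<in> \<Omega>" for z
    proof -
      have "\<exists>D. (G has_derivative D) (at z) \<and> (\<forall>c v. D (c *s v) = c *s D v)"
        using G that by (simp add: holomorphic_map_on_def)
      then show ?thesis unfolding D_def by (rule someI_ex)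
    qed
    have near: "cball z (e / 2) \<subseteq> N" if "z \<in> ball x (e / 2)" for z
    proof
      fix u assume "u \<in> cball z (e / 2)"
      then show "u \<in> N"
        using that dist_triangle[of x u z] by (intro ball_N[OF x]) simp
    qed
    have "L-lipschitz_on (ball x (e / 2)) G"
    proof (rule bounded_derivative_imp_lipschitz)
      fix z assume z: "z \<in> ball x (e / 2)"
      have z\<Omega>: "cball z (e / 2) \<subseteq> \<Omega>" using near[OF z] N\<Omega> by (rule subset_trans)
      then have "z \<in> \<Omega>" using e by (meson centre_in_cball half_gt_zero less_imp_le subsetD)
      note Dz = D[OF this]
      then show "(G has_derivative D z) (at z within ball x (e / 2))"
        using has_derivative_at_withinI by blast
      have "norm (D z v) \<le> L * norm v" for v
        unfolding L_def using Dz near[OF z] B(2) e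
        by (intro holomorphic_map_derivative_bound[OF G _ z\<Omega>]) auto
      then show "onorm (D z) \<le> L" by (rule onorm_le)
    qed (use L in auto)
    from lipschitz_on_normD[OF this, of y x] show ?thesis
      using xy e by (simp add: dist_commute)
  qed
  then show thesis using that[of "e / 2" L] e L by simp
qed

lemma abs_continuous_onE:
  assumes "abs_continuous_on I \<sigma>" "e > 0"
  obtains d where "d > 0" "\<And>(n::nat) l u. (\<forall>i<n. l i \<le> u i \<and> {l i..u i} \<subseteq> I) \<and>
        (\<forall>i<n. \<forall>j<n. i \<noteq> j \<longrightarrow> {l i<..<u i} \<inter> {l j<..<u j} = {}) \<and>
        (\<Sum>i<n. u i - l i) < d \<Longrightarrow> (\<Sum>i<n. norm (\<sigma> (u i) - \<sigma> (l i))) < e"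
proof -
  from assms(1)[unfolded abs_continuous_on_def, THEN spec, THEN mp, OF assms(2)]
  obtain d where "d > 0" and d: "\<forall>(n::nat) l u. (\<forall>i<n. l i \<le> u i \<and> {l i..u i} \<subseteq> I) \<and>
        (\<forall>i<n. \<forall>j<n. i \<noteq> j \<longrightarrow> {l i<..<u i} \<inter> {l j<..<u j} = {}) \<and>
        (\<Sum>i<n. u i - l i) < d \<longrightarrow> (\<Sum>i<n. norm (\<sigma> (u i) - \<sigma> (l i))) < e"
    by (elim exE conjE)
  show thesis
    by (rule that[OF \<open>d > 0\<close>]) (rule d[THEN spec, THEN spec, THEN spec, THEN mp])
qed

lemma abs_continuous_on_imp_continuous_on:
  assumes "abs_continuous_on {a..b} \<sigma>"
  shows "continuous_on {a..b} \<sigma>"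
  unfolding continuous_on_iff
proof (intro ballI allI impI)
  fix s e :: real assume s: "s \<in> {a..b}" and "e > 0"
  show "\<exists>d>0. \<forall>t\<in>{a..b}. dist t s < d \<longrightarrow> dist (\<sigma> t) (\<sigma> s) < e"
  proof (rule abs_continuous_onE[OF assms \<open>e > 0\<close>])
    fix d assume "d > 0" and d: "\<And>(n::nat) l u. (\<forall>i<n. l i \<le> u i \<and> {l i..u i} \<subseteq> {a..b}) \<and>
        (\<forall>i<n. \<forall>j<n. i \<noteq> j \<longrightarrow> {l i<..<u i} \<inter> {l j<..<u j} = {}) \<and>
        (\<Sum>i<n. u i - l i) < d \<Longrightarrow> (\<Sum>i<n. norm (\<sigma> (u i) - \<sigma> (l i))) < e"
    have "dist (\<sigma> t) (\<sigma> s) < e" if t: "t \<in> {a..b}" "dist t s < d" for t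
    proof (cases "s \<le> t")
      case True
      then show ?thesis using d[of 1 "\<lambda>_. s" "\<lambda>_. t"] s t by (simp add: dist_norm)
    next
      case False
      then show ?thesis using d[of 1 "\<lambda>_. t" "\<lambda>_. s"] s t by (simp add: dist_norm norm_minus_commute)
    qed
    then show ?thesis using \<open>d > 0\<close> by (intro exI[of _ d]) simp
  qed
qed

text \<open>The Lipschitz estimate holds only at distances below \<open>r\<close>. Keeping the sum
  of all increments of \<open>\<sigma>\<close> below \<open>r\<close> keeps each single increment
  within its reach.\<close>

lemma abs_continuous_on_holomorphic_map:
  assumes "open \<Omega>" and G: "holomorphic_map_on \<Omega> G"
    and \<sigma>: "abs_continuous_on {a..b} \<sigma>" "\<sigma> ` {a..b} \<subseteq> \<Omega>"
  shows "abs_continuous_on {a..b} (G \<circ> \<sigma>)"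
  unfolding abs_continuous_on_def
proof (intro allI impI)
  fix e :: real assume "e > 0"
  have "compact (\<sigma> ` {a..b})"
    using abs_continuous_on_imp_continuous_on[OF \<sigma>(1)] by (intro compact_continuous_image) auto
  then obtain r L where r: "r > 0" and L: "L \<ge> 0"
    and lip: "\<And>x y. x \<in> \<sigma> ` {a..b} \<Longrightarrow> dist x y < r \<Longrightarrow> norm (G y - G x) \<le> L * norm (y - x)"
    using holomorphic_map_uniformly_lipschitz[OF \<open>open \<Omega>\<close> G _ \<sigma>(2)] by metis
  define e' where "e' = min r (e / (L + 1))"
  have "e' > 0" using r L \<open>e > 0\<close> by (simp add: e'_def)
  then obtain d where d: "d > 0" "\<And>(n::nat) l u. (\<forall>i<n. l i \<le> u i \<and> {l i..u i} \<subseteq> {a..b}) \<and>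
        (\<forall>i<n. \<forall>j<n. i \<noteq> j \<longrightarrow> {l i<..<u i} \<inter> {l j<..<u j} = {}) \<and>
        (\<Sum>i<n. u i - l i) < d \<Longrightarrow> (\<Sum>i<n. norm (\<sigma> (u i) - \<sigma> (l i))) < e'"
    by (rule abs_continuous_onE[OF \<sigma>(1)]) (rule that)
  show "\<exists>\<delta>>0. \<forall>(n::nat) l u.
        (\<forall>i<n. l i \<le> u i \<and> {l i..u i} \<subseteq> {a..b}) \<and>
        (\<forall>i<n. \<forall>j<n. i \<noteq> j \<longrightarrow> {l i<..<u i} \<inter> {l j<..<u j} = {}) \<and>
        (\<Sum>i<n. u i - l i) < \<delta>
        \<longrightarrow> (\<Sum>i<n. norm ((G \<circ> \<sigma>) (u i) - (G \<circ> \<sigma>) (l i))) < e"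
  proof (intro exI[of _ d] conjI allI impI, goal_cases)
    case 1 show ?case by fact
  next
    case (2 n l u)
    note small = d(2)[OF 2]
    have "norm ((G \<circ> \<sigma>) (u i) - (G \<circ> \<sigma>) (l i)) \<le> L * norm (\<sigma> (u i) - \<sigma> (l i))" if i: "i \<in> {..<n}" for i
    proof -
      have "norm (\<sigma> (u i) - \<sigma> (l i)) \<le> (\<Sum>i<n. norm (\<sigma> (u i) - \<sigma> (l i)))"
        using i by (intro member_le_sum) auto
      also have "\<dots> < e'" by (rule small)
      also have "\<dots> \<le> r" by (simp add: e'_def)
      finally have "dist (\<sigma> (l i)) (\<sigma> (u i)) < r" by (simp add: dist_norm norm_minus_commute)
      moreover have "l i \<in> {a..b}" using 2 i by auto
      ultimately show ?thesis using lip by simp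
    qed
    then have "(\<Sum>i<n. norm ((G \<circ> \<sigma>) (u i) - (G \<circ> \<sigma>) (l i))) \<le> (\<Sum>i<n. L * norm (\<sigma> (u i) - \<sigma> (l i)))"
      by (rule sum_mono)
    also have "\<dots> = L * (\<Sum>i<n. norm (\<sigma> (u i) - \<sigma> (l i)))" by (simp add: sum_distrib_left)
    also have "\<dots> \<le> L * (e / (L + 1))"
      using small L by (intro mult_left_mono) (auto simp: e'_def)
    also have "\<dots> < e" using L \<open>e > 0\<close> by (simp add: field_simps)
    finally show ?case .
  qed
qed

text \<open>The constants survive because \<open>G\<close> preserves the distance exactly, thanks to
  the inverse \<open>H\<close>, and does not increase the Royden length of velocities.\<close>

lemma almost_geodesic_biholomorphic:
  assumes "open \<Omega>" and G: "holomorphic_map_on \<Omega> G" "G ` \<Omega> \<subseteq> \<Omega>'"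
    and H: "holomorphic_map_on \<Omega>' H" "H ` \<Omega>' \<subseteq> \<Omega>"
    and inv: "\<And>z. z \<in> \<Omega> \<Longrightarrow> H (G z) = z"
    and \<sigma>: "almost_geodesic \<Omega> l k {a..b} \<sigma>"
  shows "almost_geodesic \<Omega>' l k {a..b} (G \<circ> \<sigma>)"
  unfolding almost_geodesic_def
proof (intro conjI)
  have img: "\<sigma> ` {a..b} \<subseteq> \<Omega>" using \<sigma> by (simp add: almost_geodesic_def)
  then have img': "\<sigma> t \<in> \<Omega>" if "t \<in> {a..b}" for t using that by blast
  show "(G \<circ> \<sigma>) ` {a..b} \<subseteq> \<Omega>'" using img G(2) by (metis image_comp image_mono subset_trans)
  show "\<forall>s\<in>{a..b}. \<forall>t\<in>{a..b}. 1 / l * \<bar>s - t\<bar> - k \<le> kobayashi_dist \<Omega>' ((G \<circ> \<sigma>) s) ((G \<circ> \<sigma>) t) \<and>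
                    kobayashi_dist \<Omega>' ((G \<circ> \<sigma>) s) ((G \<circ> \<sigma>) t) \<le> l * \<bar>s - t\<bar> + k"
    using \<sigma> kobayashi_dist_biholomorphic[OF G H inv img' img'] by (simp add: almost_geodesic_def)
  show "abs_continuous_on {a..b} (G \<circ> \<sigma>)"
    using \<sigma> by (intro abs_continuous_on_holomorphic_map[OF \<open>open \<Omega>\<close> G(1) _ img]) (simp add: almost_geodesic_def)
  have "AE t in lebesgue. t \<in> {a..b} \<longrightarrow>
        (\<exists>v. (\<sigma> has_vector_derivative v) (at t within {a..b}) \<and> kobayashi_royden \<Omega> (\<sigma> t) v \<le> l)"
    using \<sigma> by (simp add: almost_geodesic_def)
  then show "AE t in lebesgue. t \<in> {a..b} \<longrightarrow>
        (\<exists>v. (G \<circ> \<sigma> has_vector_derivative v) (at t within {a..b}) \<and> kobayashi_royden \<Omega>' ((G \<circ> \<sigma>) t) v \<le> l)"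
  proof (rule AE_mp, intro AE_I2 impI)
    fix t assume t: "t \<in> {a..b}" and "t \<in> {a..b} \<longrightarrow>
        (\<exists>v. (\<sigma> has_vector_derivative v) (at t within {a..b}) \<and> kobayashi_royden \<Omega> (\<sigma> t) v \<le> l)"
    then obtain v where v: "(\<sigma> has_vector_derivative v) (at t within {a..b})" "kobayashi_royden \<Omega> (\<sigma> t) v \<le> l"
      by metis
    obtain D where D: "(G has_derivative D) (at (\<sigma> t))" "\<And>c v. D (c *s v) = c *s D v"
      using holomorphic_map_onD[OF G(1) img'[OF t]] by metis
    have "(G \<circ> \<sigma> has_derivative D \<circ> (\<lambda>h. h *\<^sub>R v)) (at t within {a..b})"
      using v(1) has_derivative_at_withinI[OF D(1)] unfolding has_vector_derivative_def by (rule diff_chain_within)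
    moreover have "D \<circ> (\<lambda>h. h *\<^sub>R v) = (\<lambda>h. h *\<^sub>R D v)"
      using linear_scale[OF has_derivative_linear[OF D(1)]] by (simp add: fun_eq_iff)
    ultimately have "(G \<circ> \<sigma> has_vector_derivative D v) (at t within {a..b})"
      by (simp add: has_vector_derivative_def)
    moreover have "kobayashi_royden \<Omega>' ((G \<circ> \<sigma>) t) (D v) \<le> l"
      using kobayashi_royden_holomorphic_map_le[OF \<open>open \<Omega>\<close> G img'[OF t] D, of v] v(2) by simp
    ultimately show "\<exists>v. (G \<circ> \<sigma> has_vector_derivative v) (at t within {a..b}) \<and> kobayashi_royden \<Omega>' ((G \<circ> \<sigma>) t) v \<le> l"
      by metis
  qed
qed

section \<open>Components of a visibility domain off a compact set\<close>

text \<open>A ball around a limit in \<open>S\<close> is connected, hence contained in every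
  component that it meets, and all late \<open>U n\<close> meet it.\<close>

lemma limit_of_distinct_components:
  fixes y :: "nat \<Rightarrow> 'a::real_normed_vector"
  assumes "open S" and U: "\<And>n. U n \<in> components S" "inj U" and y: "\<And>n. y n \<in> U n" "y \<longlonglongrightarrow> l"
  shows "l \<notin> S"
proof
  assume "l \<in> S"
  then obtain r where r: "r > 0" "ball l r \<subseteq> S" using \<open>open S\<close> open_contains_ball by metis
  obtain N where N: "\<And>n. n \<ge> N \<Longrightarrow> y n \<in> ball l r"
    using y(2) r(1) unfolding lim_sequentially by (metis dist_commute mem_ball)
  have sub: "ball l r \<subseteq> U n" if "n \<ge> N" for n
  proof (rule components_maximal[OF U(1)])
    show "U n \<inter> ball l r \<noteq> {}" using N[OF that] y(1)[of n] by (metis IntI emptyE)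
  qed (use r in auto)
  have "l \<in> U N \<inter> U (Suc N)" using sub[of N] sub[of "Suc N"] r by auto
  then have "U N = U (Suc N)"
    using components_nonoverlap[OF U(1)[of N] U(1)[of "Suc N"]] by auto
  then show False using U(2) by (metis injD n_not_Suc_n)
qed

text \<open>The distance is attained by compactness, and a value of at most \<open>d\<close> would
  place \<open>y\<close> in one of the balls.\<close>

lemma infdist_gt_thicken:
  fixes C :: "'a::heine_borel set"
  assumes C: "compact C" "C \<noteq> {}" and sub: "(\<Union>x\<in>C. cball x d) \<subseteq> S" and "y \<notin> S"
  shows "infdist y C > d"
proof -
  obtain x where "x \<in> C" "infdist y C = dist y x"
    using infdist_attains_inf[OF compact_imp_closed[OF C(1)] C(2)] by metis
  then show ?thesis using sub \<open>y \<notin> S\<close> by (force simp: dist_commute not_less)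
qed

text \<open>
  Join \<open>x\<close> to a point of \<open>U'\<close> by an almost-geodesic; it has to leave \<open>U\<close>, hence to hit \<open>B\<close>. The
  piece wanted runs up to the first hitting time, from a time at which the distance to \<open>B\<close> is \<open>d\<close>.
\<close>

lemma crossing_almost_geodesic:
  fixes \<Omega> :: "(complex ^ 'd) set"
  assumes dom: "domain \<Omega>" and hyp: "hyperbolic \<Omega>"
    and A: "compact A" and B: "compact B" and P: "open P" "A \<subseteq> P" "P \<inter> \<Omega> \<subseteq> B"
    and d: "d > 0" "(\<Union>x\<in>B. cball x d) \<subseteq> Q"
    and U: "U \<in> components (\<Omega> - A)" "x \<in> U" "x \<notin> Q"
    and U': "U' \<in> components (\<Omega> - A)" "U' \<noteq> U"
  obtains R \<tau> where "0 \<le> R" "almost_geodesic \<Omega> 1 1 {0..R} \<tau>" "\<tau> ` {0..R} \<subseteq> U - P"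
    "infdist (\<tau> 0) B = d" "\<tau> R \<in> B"
proof -
  obtain x' where x': "x' \<in> U'" using U'(1) in_components_nonempty by (metis all_not_in_conv)
  have U\<Omega>: "U \<subseteq> \<Omega> - A" "U' \<subseteq> \<Omega> - A" using U U' in_components_subset by metis+
  have x\<Omega>: "x \<in> \<Omega>" "x' \<in> \<Omega>" using U\<Omega> U(2) x' by auto
  obtain T \<sigma> where \<sigma>: "unit_speed_curve \<Omega> T \<sigma>" "\<sigma> 0 = x" "\<sigma> T = x'"
    and low: "\<And>s t. s \<in> {0..T} \<Longrightarrow> t \<in> {0..T} \<Longrightarrow> \<bar>s - t\<bar> - 1 \<le> kobayashi_dist \<Omega> (\<sigma> s) (\<sigma> t)"
    by (rule almost_minimal_curve_exists[OF dom hyp x\<Omega> zero_less_one]) (rule that)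
  have T: "0 \<le> T" and img: "\<sigma> ` {0..T} \<subseteq> \<Omega>" using \<sigma>(1) by (auto simp: unit_speed_curve_def)
  have cont: "continuous_on {0..T} \<sigma>"
    using \<sigma>(1) lipschitz_on_continuous_on unfolding unit_speed_curve_def by metis
  have stay: "\<sigma> ` {0..s} \<subseteq> U" if s: "0 \<le> s" "s \<le> T" "\<sigma> ` {0..s} \<inter> A = {}" for s
  proof (rule components_maximal[OF U(1)])
    have "continuous_on {0..s} \<sigma>" using cont s by (auto intro: continuous_on_subset)
    then show "connected (\<sigma> ` {0..s})" by (rule connected_continuous_image) simp
    have "\<sigma> ` {0..s} \<subseteq> \<sigma> ` {0..T}" using s by (intro image_mono) auto
    then show "\<sigma> ` {0..s} \<subseteq> \<Omega> - A" using img s(3) by auto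
    have "x \<in> \<sigma> ` {0..s}" using \<sigma>(2) s by force
    then show "U \<inter> \<sigma> ` {0..s} \<noteq> {}" using U(2) by auto
  qed
  \<comment> \<open>Otherwise the curve avoids \<open>A\<close>, whose part in
    \<open>\<Omega>\<close> lies in \<open>B\<close>, and so stays in \<open>U\<close>, although it
    ends in another component.\<close>
  have "\<exists>t\<in>{0..T}. \<sigma> t \<in> B"
  proof (rule ccontr)
    assume no: "\<not> ?thesis"
    have "\<sigma> t \<notin> A" if "t \<in> {0..T}" for t
      using no that img P by (metis IntI imageI subsetD)
    then have "\<sigma> ` {0..T} \<inter> A = {}" by auto
    then have "\<sigma> ` {0..T} \<subseteq> U" using stay[of T] T by simp
    then have "x' \<in> U" using \<sigma>(3) T by force
    then show False using components_nonoverlap[OF U(1) U'(1)] U'(2) x' by auto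
  qed
  then have ne: "B \<noteq> {}" by auto
  define S where "S = {0..T} \<inter> \<sigma> -` B"
  have "closed S" unfolding S_def
    using cont compact_imp_closed[OF B] by (intro continuous_closed_preimage) auto
  then have "compact S" unfolding S_def by (meson bounded_Int bounded_closed_interval compact_eq_bounded_closed)
  moreover have "S \<noteq> {}" using \<open>\<exists>t\<in>{0..T}. \<sigma> t \<in> B\<close> by (auto simp: S_def)
  ultimately obtain s2 where s2: "s2 \<in> S" "\<And>t. t \<in> S \<Longrightarrow> s2 \<le> t"
    using compact_attains_inf by metis
  have s2T: "0 \<le> s2" "s2 \<le> T" "\<sigma> s2 \<in> B" using s2(1) by (auto simp: S_def)
  define h where "h t = infdist (\<sigma> t) B" for t
  have h0: "h 0 > d" unfolding h_def \<sigma>(2) by (rule infdist_gt_thicken[OF B ne d(2) U(3)])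
  have hs2: "h s2 = 0" using s2T(3) by (simp add: h_def)
  have "s2 \<noteq> 0" using h0 hs2 d by auto
  then have s2pos: "s2 > 0" using s2T by simp
  \<comment> \<open>Before the first hitting time the curve is off \<open>B\<close>, hence off
    \<open>P\<close>; since \<open>P\<close> is open, this persists at \<open>s2\<close>
    itself.\<close>
  have notP: "\<sigma> ` {0..s2} \<subseteq> - P"
  proof -
    have "\<sigma> ` {0..<s2} \<subseteq> - P"
    proof (rule image_subsetI)
      fix t assume t: "t \<in> {0..<s2}"
      then have "t \<notin> S" using s2(2)[of t] by auto
      then have "\<sigma> t \<notin> B" "\<sigma> t \<in> \<Omega>" using t s2T img by (auto simp: S_def)
      then show "\<sigma> t \<in> - P" using P(3) by auto
    qed
    moreover have "closure {0..<s2} = {0..s2}" using s2pos by simp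
    moreover have "continuous_on {0..s2} \<sigma>" using cont s2T by (auto intro: continuous_on_subset)
    ultimately show ?thesis
      using image_closure_subset[of "{0..<s2}" \<sigma> "- P"] P(1) by (simp add: closed_Compl)
  qed
  then have "\<sigma> ` {0..s2} \<inter> A = {}" using P(2) by auto
  then have inU: "\<sigma> ` {0..s2} \<subseteq> U" by (rule stay[OF s2T(1,2)])
  have "continuous_on {0..s2} h"
    unfolding h_def using cont s2T by (intro continuous_intros) (auto intro: continuous_on_subset)
  \<comment> \<open>Cutting at distance exactly \<open>d\<close> keeps the starting points bounded
    and yet away from \<open>B\<close>, which will separate the two limits.\<close>
  then obtain s1 where s1: "0 \<le> s1" "s1 \<le> s2" "h s1 = d"
    using IVT2'[of h s2 d 0] h0 hs2 d(1) s2T by force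
  define \<tau> where "\<tau> t = \<sigma> (s1 + t)" for t
  have "unit_speed_curve \<Omega> (s2 - s1) \<tau>"
    unfolding \<tau>_def[abs_def] by (rule unit_speed_curve_subsegment[OF \<sigma>(1)]) (use s1 s2T in auto)
  then have "almost_geodesic \<Omega> 1 1 {0..s2 - s1} \<tau>"
  proof (rule unit_speed_almost_geodesic)
    fix s t assume "s \<in> {0..s2 - s1}" "t \<in> {0..s2 - s1}"
    then show "\<bar>s - t\<bar> - 1 \<le> kobayashi_dist \<Omega> (\<tau> s) (\<tau> t)"
      using low[of "s1 + s" "s1 + t"] s1 s2T by (simp add: \<tau>_def)
  qed simp
  moreover have "\<tau> ` {0..s2 - s1} \<subseteq> \<sigma> ` {0..s2}"
    unfolding \<tau>_def using s1 by (intro image_subsetI imageI) auto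
  then have "\<tau> ` {0..s2 - s1} \<subseteq> U - P" using notP inU by auto
  ultimately show thesis
    using that[of "s2 - s1" \<tau>] s1 s2T(3) by (simp add: \<tau>_def h_def)
qed

lemma compact_obtain_limit:
  fixes f :: "nat \<Rightarrow> 'a::metric_space"
  assumes "compact S" "\<And>n. f n \<in> S"
  obtains l r where "l \<in> S" "strict_mono (r :: nat \<Rightarrow> nat)" "(\<lambda>n. f (r n)) \<longlonglongrightarrow> l"
  using assms unfolding compact_def o_def by metis

text \<open>
  Infinitely many components would give almost-geodesics crossing a shell around \<open>K (Suc j)\<close> inside
  pairwise distinct components \<open>U n\<close>. A limit of points of distinct components lies outside
  \<open>\<Omega> - K j\<close>, so the limits of the end points are distinct boundary points, whereas by visibility
  the curves meet a fixed compact subset of \<open>\<Omega>\<close>.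
\<close>

lemma visibility_finite_components:
  fixes \<Omega> :: "(complex ^ 'd) set"
  assumes vis: "visibility_domain K \<Omega>" and ex: "compact_exhaustion (closure \<Omega>) K"
  shows "finite {U \<in> components (\<Omega> - K j). \<not> U \<subseteq> K (j + 2)}" (is "finite ?\<U>")
proof (rule ccontr)
  assume inf: "infinite ?\<U>"
  have dom: "domain \<Omega>" and hyp: "hyperbolic \<Omega>" using vis by (auto simp: visibility_domain_def)
  have op: "open (\<Omega> - K j)"
    using dom compact_exhaustion_props(1)[OF ex] by (intro open_Diff) (auto simp: domain_def compact_imp_closed)
  obtain U :: "nat \<Rightarrow> _" where U: "inj U" "range U \<subseteq> ?\<U>"
    using infinite_countable_subset[OF inf] by (elim exE conjE) (rule that)
  have Uc: "U n \<in> components (\<Omega> - K j)" and "\<not> U n \<subseteq> K (j + 2)" for n using U(2) by auto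
  then have "\<exists>x. x \<in> U n \<and> x \<notin> K (j + 2)" for n by auto
  then obtain x where x: "\<And>n. x n \<in> U n" "\<And>n. x n \<notin> K (j + 2)" by metis
  \<comment> \<open>Two levels are spent: \<open>P\<close> keeps the curves off a neighbourhood of
    \<open>K j\<close>, and \<open>Q\<close> contains the shell of width \<open>d\<close> around
    \<open>K (Suc j)\<close>. Hence the shift \<open>j + 2\<close>.\<close>
  obtain P where P: "open P" "K j \<subseteq> P" "P \<inter> closure \<Omega> \<subseteq> K (Suc j)"
    using compact_exhaustion_interior[OF ex] .
  obtain Q where Q: "open Q" "K (Suc j) \<subseteq> Q" "Q \<inter> closure \<Omega> \<subseteq> K (Suc (Suc j))"
    using compact_exhaustion_interior[OF ex] .
  obtain d where d: "d > 0" "(\<Union>x\<in>K (Suc j). cball x d) \<subseteq> Q"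
    using compact_subset_open_imp_cball_epsilon_subset[OF compact_exhaustion_props(1)[OF ex] Q(1,2)] .
  have P\<Omega>: "P \<inter> \<Omega> \<subseteq> K (Suc j)" using P(3) closure_subset[of \<Omega>] by auto
  have x\<Omega>: "x n \<in> closure \<Omega>" for n
    using in_components_subset[OF Uc[of n]] x(1)[of n] closure_subset[of \<Omega>] by auto
  then have xQ: "x n \<notin> Q" for n using Q(3) x(2)[of n] by auto
  have "\<exists>R \<tau>. 0 \<le> R \<and> almost_geodesic \<Omega> 1 1 {0..R} \<tau> \<and> \<tau> ` {0..R} \<subseteq> U n - P \<and>
      infdist (\<tau> 0) (K (Suc j)) = d \<and> \<tau> R \<in> K (Suc j)" for n
  proof -
    have "U (Suc n) \<noteq> U n" using U(1) by (metis injD n_not_Suc_n)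
    then show ?thesis
      using crossing_almost_geodesic[OF dom hyp compact_exhaustion_props(1)[OF ex] compact_exhaustion_props(1)[OF ex]
          P(1,2) P\<Omega> d Uc x(1) xQ Uc] by metis
  qed
  then obtain R \<tau> where R: "\<And>n. 0 \<le> R n" and ag: "\<And>n. almost_geodesic \<Omega> 1 1 {0..R n} (\<tau> n)"
    and \<tau>U: "\<And>n. \<tau> n ` {0..R n} \<subseteq> U n - P"
    and p_inf: "\<And>n. infdist (\<tau> n 0) (K (Suc j)) = d" and q_K: "\<And>n. \<tau> n (R n) \<in> K (Suc j)"
    by metis
  have ne: "K (Suc j) \<noteq> {}" using q_K by auto
  have \<tau>in: "\<tau> n t \<in> U n" "\<tau> n t \<notin> P" if "t \<in> {0..R n}" for n t
    using subsetD[OF \<tau>U imageI[OF that]] by auto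
  have \<tau>\<Omega>: "\<tau> n t \<in> closure \<Omega>" if "t \<in> {0..R n}" for n t
    using in_components_subset[OF Uc[of n]] \<tau>in(1)[OF that] closure_subset[of \<Omega>] by auto
  \<comment> \<open>A distance not exceeding \<open>d\<close> puts the starting point into
    \<open>Q\<close>, so into the compact set \<open>K (j + 2)\<close>.\<close>
  have p_K: "\<tau> n 0 \<in> K (j + 2)" for n
  proof -
    have "\<tau> n 0 \<in> Q"
      using infdist_gt_thicken[OF compact_exhaustion_props(1)[OF ex] ne d(2), of "\<tau> n 0"] p_inf[of n] by auto
    then show ?thesis using Q(3) \<tau>\<Omega>[of 0 n] R[of n] by auto
  qed
  have "compact (K (j + 2) \<times> K (Suc j))"
    by (intro compact_Times compact_exhaustion_props(1)[OF ex])
  moreover have "(\<tau> n 0, \<tau> n (R n)) \<in> K (j + 2) \<times> K (Suc j)" for n using p_K q_K by simp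
  ultimately obtain l r where l: "l \<in> K (j + 2) \<times> K (Suc j)" and r: "strict_mono r"
    and lim: "(\<lambda>n. (\<tau> (r n) 0, \<tau> (r n) (R (r n)))) \<longlonglongrightarrow> l"
    by (rule compact_obtain_limit) 
  obtain p q where lpq: "l = (p, q)" by (cases l)
  have p: "p \<in> K (j + 2)" "(\<lambda>n. \<tau> (r n) 0) \<longlonglongrightarrow> p" and q: "q \<in> K (Suc j)" "(\<lambda>n. \<tau> (r n) (R (r n))) \<longlonglongrightarrow> q"
    using l tendsto_fst[OF lim] tendsto_snd[OF lim] by (simp_all add: lpq)
  have Ur: "inj (\<lambda>n. U (s n))" if "strict_mono (s :: nat \<Rightarrow> nat)" for s
    using inj_compose[OF U(1) strict_mono_imp_inj_on[OF that]] by (simp add: o_def)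
  \<comment> \<open>Distinct components exclude limits in \<open>\<Omega> - K j\<close>; limits in
    \<open>K j\<close> are excluded because all points stay off the open set \<open>P\<close> around
    it.\<close>
  have limit: "l \<notin> \<Omega>" if s: "strict_mono (s :: nat \<Rightarrow> nat)" and "\<And>n. y n \<in> U (s n)" "\<And>n. y n \<notin> P" "y \<longlonglongrightarrow> l" for y s l
  proof -
    have "l \<notin> \<Omega> - K j"
      by (rule limit_of_distinct_components[OF op Uc Ur[OF s], of y]) fact+
    moreover have "l \<in> - P"
      by (rule closed_sequentially[of "- P" y]) (use P(1) that in auto)
    ultimately show ?thesis using P(2) by auto
  qed
  have "p \<notin> \<Omega>"
    by (rule limit[OF r _ _ p(2)]) (use \<tau>in R in auto)
  have "q \<notin> \<Omega>"
    by (rule limit[OF r _ _ q(2)]) (use \<tau>in R in auto)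
  \<comment> \<open>In the limit \<open>p\<close> keeps the positive distance \<open>d\<close> from
    \<open>K (Suc j)\<close>, a set that contains \<open>q\<close>.\<close>
  have "(\<lambda>n. infdist (\<tau> (r n) 0) (K (Suc j))) \<longlonglongrightarrow> infdist p (K (Suc j))"
    by (rule tendsto_infdist[OF p(2)])
  then have "infdist p (K (Suc j)) = d" by (simp add: p_inf LIMSEQ_const_iff)
  then have "p \<noteq> q" using q(1) d(1) by auto
  have cl: "p \<in> closure \<Omega>" "q \<in> closure \<Omega>"
    using p(1) q(1) compact_exhaustion_props(2)[OF ex] by (metis subsetD)+
  then have "Pt p \<in> end_boundary K \<Omega>" "Pt q \<in> end_boundary K \<Omega>" "Pt p \<noteq> Pt q"
    using \<open>p \<notin> \<Omega>\<close> \<open>q \<notin> \<Omega>\<close> \<open>p \<noteq> q\<close> by (auto simp: end_boundary_def)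
  then have "visibility_property K \<Omega> 1 1 (Pt p) (Pt q)"
    using vis by (simp add: visibility_domain_def)
  then obtain V W C where V: "openin (end_compactification K \<Omega>) V" "Pt p \<in> V"
    and W: "openin (end_compactification K \<Omega>) W" "Pt q \<in> W" and C: "compact C" "C \<subseteq> \<Omega>"
    and hit: "\<And>T \<sigma>. 0 \<le> T \<Longrightarrow> almost_geodesic \<Omega> 1 1 {0..T} \<sigma> \<Longrightarrow> Pt (\<sigma> 0) \<in> V \<Longrightarrow> Pt (\<sigma> T) \<in> W
           \<Longrightarrow> \<sigma> ` {0..T} \<inter> C \<noteq> {}"
    unfolding visibility_property_def by metis
  have ev: "\<exists>N. \<forall>n\<ge>N. Pt (y n) \<in> V'" if V': "openin (end_compactification K \<Omega>) V'" "Pt l \<in> V'"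
    and y: "y \<longlonglongrightarrow> l" "\<And>n. y n \<in> closure \<Omega>" for V' l and y :: "nat \<Rightarrow> _"
  proof -
    obtain e where e: "e > 0" "Pt ` (ball l e \<inter> closure \<Omega>) \<subseteq> V'"
      using V' by (metis openin_end_compactification)
    obtain N where "\<And>n. n \<ge> N \<Longrightarrow> y n \<in> ball l e"
      using y(1) e(1) unfolding lim_sequentially by (metis dist_commute mem_ball)
    then show ?thesis using e(2) y(2) by (metis IntI imageI subsetD)
  qed
  obtain N1 where N1: "\<And>n. n \<ge> N1 \<Longrightarrow> Pt (\<tau> (r n) 0) \<in> V"
    using ev[OF V p(2)] \<tau>\<Omega> R by (metis atLeastAtMost_iff order_refl)
  obtain N2 where N2: "\<And>n. n \<ge> N2 \<Longrightarrow> Pt (\<tau> (r n) (R (r n))) \<in> W"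
    using ev[OF W q(2)] \<tau>\<Omega> R by (metis atLeastAtMost_iff order_refl)
  define s where "s n = r (n + (N1 + N2))" for n
  have s: "strict_mono s" using r by (simp add: s_def strict_mono_def)
  have "\<exists>t. t \<in> {0..R (s n)} \<and> \<tau> (s n) t \<in> C" for n
    using hit[OF R ag, of "s n"] N1[of "n + (N1 + N2)"] N2[of "n + (N1 + N2)"] unfolding s_def by force
  then obtain t where t: "\<And>n. t n \<in> {0..R (s n)}" "\<And>n. \<tau> (s n) (t n) \<in> C" by metis
  obtain m u where m: "m \<in> C" "strict_mono u" "(\<lambda>n. \<tau> (s (u n)) (t (u n))) \<longlonglongrightarrow> m"
    by (rule compact_obtain_limit[OF C(1) t(2)])
  \<comment> \<open>The hitting points also lie in distinct components and off \<open>P\<close>, so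
    they cannot accumulate in \<open>\<Omega>\<close>, yet compactness of \<open>C\<close> makes
    them do so.\<close>
  have "m \<notin> \<Omega>"
  proof (rule limit[OF _ _ _ m(3), of "\<lambda>n. s (u n)"])
    show "strict_mono (\<lambda>n. s (u n))" using s m(2) by (simp add: strict_mono_def)
    show "\<tau> (s (u n)) (t (u n)) \<in> U (s (u n))" "\<tau> (s (u n)) (t (u n)) \<notin> P" for n
      using \<tau>in[OF t(1)] by auto
  qed
  then show False using m(1) C(2) by auto
qed

lemma visibility_domain_compact_end_compactification:
  fixes \<Omega> :: "(complex ^ 'd) set"
  assumes vis: "visibility_domain K \<Omega>" and ex: "compact_exhaustion (closure \<Omega>) K"
  shows "compact_space (end_compactification K \<Omega>)"
proof (rule compact_space_end_compactification[OF ex, where m = 2])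
  fix j
  have "K j \<subseteq> K (j + 2)"
    using compact_exhaustion_props(3)[OF ex, of j] compact_exhaustion_props(3)[OF ex, of "Suc j"] by simp
  then show "finite {E \<in> components (closure \<Omega> - K j). \<not> E \<subseteq> K (j + 2)}"
    using visibility_finite_components[OF vis ex] compact_exhaustion_props(1)[OF ex] compact_imp_closed
    by (intro finite_components_closure) auto
qed

section \<open>Transfer of visibility along the extended biholomorphism\<close>

theorem theorem1p7:
  fixes \<Omega> \<Omega>\<^sub>0 :: "(complex ^ 'd) set"
    and K K\<^sub>0 :: "nat \<Rightarrow> (complex ^ 'd) set"
  assumes "domain \<Omega>" and "hyperbolic \<Omega>"
    and "compact_exhaustion (closure \<Omega>) K"
    and "compact_exhaustion (closure \<Omega>\<^sub>0) K\<^sub>0"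
    and "visibility_domain K\<^sub>0 \<Omega>\<^sub>0"
    and "\<exists>\<Phi> \<Psi>. biholomorphism \<Omega>\<^sub>0 \<Omega> \<Phi> \<and>
           continuous_map (end_compactification K\<^sub>0 \<Omega>\<^sub>0) (end_compactification K \<Omega>) \<Psi> \<and>
           \<Psi> ` topspace (end_compactification K\<^sub>0 \<Omega>\<^sub>0) = topspace (end_compactification K \<Omega>) \<and>
           (\<forall>z\<in>\<Omega>\<^sub>0. \<Psi> (Pt z) = Pt (\<Phi> z))"
  shows "visibility_domain K \<Omega>"
proof -
  define X where "X = end_compactification K \<Omega>"
  define X0 where "X0 = end_compactification K\<^sub>0 \<Omega>\<^sub>0"
  obtain \<Phi> \<Psi> where bi: "biholomorphism \<Omega>\<^sub>0 \<Omega> \<Phi>" and \<Psi>: "continuous_map X0 X \<Psi>"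
    and surj: "\<Psi> ` topspace X0 = topspace X" and ext: "\<And>z. z \<in> \<Omega>\<^sub>0 \<Longrightarrow> \<Psi> (Pt z) = Pt (\<Phi> z)"
    using assms(6) unfolding X_def X0_def by metis
  define G where "G = the_inv_into \<Omega>\<^sub>0 \<Phi>"
  have bij: "bij_betw \<Phi> \<Omega>\<^sub>0 \<Omega>" and hol\<Phi>: "holomorphic_map_on \<Omega>\<^sub>0 \<Phi>" and holG: "holomorphic_map_on \<Omega> G"
    using bi by (auto simp: biholomorphism_def G_def)
  have im\<Phi>: "\<Phi> ` \<Omega>\<^sub>0 \<subseteq> \<Omega>" using bij by (simp add: bij_betw_def)
  have imG: "G ` \<Omega> \<subseteq> \<Omega>\<^sub>0" using bij_betw_the_inv_into[OF bij] by (simp add: bij_betw_def G_def)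
  have inv: "\<Phi> (G z) = z" if "z \<in> \<Omega>" for z
    unfolding G_def by (rule f_the_inv_into_f_bij_betw[OF bij that])
  have "open \<Omega>" using assms(1) by (simp add: domain_def)
  have X0: "compact_space X0" "Hausdorff_space X0"
    unfolding X0_def by (intro visibility_domain_compact_end_compactification Hausdorff_space_end_compactification assms)+
  have "Hausdorff_space X" unfolding X_def by (intro Hausdorff_space_end_compactification assms)
  \<comment> \<open>Visibility of \<open>\<Omega>\<close> is not yet available, so compactness is
    inherited through the surjection \<open>\<Psi>\<close>; it later provides neighbourhoods with
    disjoint closures.\<close>
  moreover have "compact_space X"
    using image_compactin[OF _ \<Psi>, of "topspace X0"] X0(1) surj by (simp add: compact_space_def)
  ultimately have X: "compact_space X" "Hausdorff_space X" by simp_all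
  have closed_\<Psi>: "closed_map X0 X \<Psi>"
    by (rule continuous_imp_closed_map[OF \<Psi> X0(1) X(2)])
  have "visibility_property K \<Omega> l k \<zeta> \<eta>"
    if lk: "l \<ge> 1" "k > 0" and \<zeta>: "\<zeta> \<in> end_boundary K \<Omega>" and \<eta>: "\<eta> \<in> end_boundary K \<Omega>" and "\<zeta> \<noteq> \<eta>" for l k \<zeta> \<eta>
  proof -
    have \<zeta>X: "\<zeta> \<in> topspace X" and \<eta>X: "\<eta> \<in> topspace X"
      using \<zeta> \<eta> by (simp_all add: end_boundary_def X_def)
    define fib where "fib x = {y \<in> topspace X0. \<Psi> y = x}" for x
    have fib_compact: "compactin X0 (fib x)" if "x \<in> topspace X" for x
    proof -
      have "closedin X {x}" using X(2) that by (simp add: closedin_Hausdorff_singleton)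
      then have "closedin X0 (fib x)"
        using closedin_continuous_map_preimage[OF \<Psi>, of "{x}"] by (simp add: fib_def)
      then show ?thesis using X0(1) closedin_compact_space by metis
    qed
    \<comment> \<open>\<open>\<Psi>\<close> extends \<open>\<Phi>\<close> and so sends points of
      \<open>\<Omega>\<^sub>0\<close> into \<open>\<Omega>\<close>; nothing over a boundary point
      can be interior.\<close>
    have fib_bd: "y \<in> end_boundary K\<^sub>0 \<Omega>\<^sub>0" if y: "y \<in> fib x" and x: "x \<in> end_boundary K \<Omega>" for x y
    proof -
      have "y \<notin> Pt ` \<Omega>\<^sub>0"
      proof
        assume "y \<in> Pt ` \<Omega>\<^sub>0"
        then obtain z where "z \<in> \<Omega>\<^sub>0" "y = Pt z" by auto
        then have "x = Pt (\<Phi> z)" "\<Phi> z \<in> \<Omega>" using y ext im\<Phi> by (auto simp: fib_def)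
        then show False using x by (simp add: end_boundary_def)
      qed
      then show ?thesis using y by (simp add: end_boundary_def fib_def X0_def)
    qed
    \<comment> \<open>Visibility stripped of the condition on closures: in this form it is monotone,
      and stable under unions in either argument by uniting the compact sets.\<close>
    define P where "P V W \<longleftrightarrow> (\<exists>C. compact C \<and> C \<subseteq> \<Omega>\<^sub>0 \<and>
        (\<forall>T \<sigma>. 0 \<le> T \<and> almost_geodesic \<Omega>\<^sub>0 l k {0..T} \<sigma> \<and> Pt (\<sigma> 0) \<in> V \<and> Pt (\<sigma> T) \<in> W
           \<longrightarrow> \<sigma> ` {0..T} \<inter> C \<noteq> {}))" for V W
    have "\<exists>V W. openin X0 V \<and> openin X0 W \<and> fib \<zeta> \<subseteq> V \<and> fib \<eta> \<subseteq> W \<and> P V W"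
    proof (rule compactin_tube[OF fib_compact[OF \<zeta>X] fib_compact[OF \<eta>X]])
      fix a b assume a: "a \<in> fib \<zeta>" and b: "b \<in> fib \<eta>"
      have "a \<noteq> b" using a b \<open>\<zeta> \<noteq> \<eta>\<close> by (auto simp: fib_def)
      then have "visibility_property K\<^sub>0 \<Omega>\<^sub>0 l k a b"
        using assms(5) lk fib_bd[OF a \<zeta>] fib_bd[OF b \<eta>] by (simp add: visibility_domain_def)
      then show "\<exists>V W. openin X0 V \<and> openin X0 W \<and> a \<in> V \<and> b \<in> W \<and> P V W"
        unfolding visibility_property_def P_def X0_def by metis
    next
      fix V W V' W' assume "P V W" "V' \<subseteq> V" "W' \<subseteq> W"
      then show "P V' W'" unfolding P_def by (metis subsetD)
    next
      show "P V {}" "P {} V" for V unfolding P_def by (intro exI[of _ "{}"], simp)+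
    next
      fix V V' W assume "P V W" "P V' W"
      then obtain C C' where C: "compact C" "C \<subseteq> \<Omega>\<^sub>0" "compact C'" "C' \<subseteq> \<Omega>\<^sub>0"
        and hit: "\<And>T \<sigma>. 0 \<le> T \<and> almost_geodesic \<Omega>\<^sub>0 l k {0..T} \<sigma> \<and> Pt (\<sigma> 0) \<in> V \<and> Pt (\<sigma> T) \<in> W \<Longrightarrow> \<sigma> ` {0..T} \<inter> C \<noteq> {}"
          "\<And>T \<sigma>. 0 \<le> T \<and> almost_geodesic \<Omega>\<^sub>0 l k {0..T} \<sigma> \<and> Pt (\<sigma> 0) \<in> V' \<and> Pt (\<sigma> T) \<in> W \<Longrightarrow> \<sigma> ` {0..T} \<inter> C' \<noteq> {}"
        unfolding P_def by metis
      then show "P (V \<union> V') W"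
        unfolding P_def by (intro exI[of _ "C \<union> C'"]) (auto simp: Int_Un_distrib)
    next
      fix V W W' assume "P V W" "P V W'"
      then obtain C C' where C: "compact C" "C \<subseteq> \<Omega>\<^sub>0" "compact C'" "C' \<subseteq> \<Omega>\<^sub>0"
        and hit: "\<And>T \<sigma>. 0 \<le> T \<and> almost_geodesic \<Omega>\<^sub>0 l k {0..T} \<sigma> \<and> Pt (\<sigma> 0) \<in> V \<and> Pt (\<sigma> T) \<in> W \<Longrightarrow> \<sigma> ` {0..T} \<inter> C \<noteq> {}"
          "\<And>T \<sigma>. 0 \<le> T \<and> almost_geodesic \<Omega>\<^sub>0 l k {0..T} \<sigma> \<and> Pt (\<sigma> 0) \<in> V \<and> Pt (\<sigma> T) \<in> W' \<Longrightarrow> \<sigma> ` {0..T} \<inter> C' \<noteq> {}"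
        unfolding P_def by metis
      then show "P V (W \<union> W')"
        unfolding P_def by (intro exI[of _ "C \<union> C'"]) (auto simp: Int_Un_distrib)
    qed
    then obtain V0 W0 where VW0: "openin X0 V0" "openin X0 W0" "fib \<zeta> \<subseteq> V0" "fib \<eta> \<subseteq> W0" and "P V0 W0"
      by metis
    then obtain C where C: "compact C" "C \<subseteq> \<Omega>\<^sub>0"
      and hit: "\<And>T \<sigma>. 0 \<le> T \<Longrightarrow> almost_geodesic \<Omega>\<^sub>0 l k {0..T} \<sigma> \<Longrightarrow> Pt (\<sigma> 0) \<in> V0 \<Longrightarrow> Pt (\<sigma> T) \<in> W0
        \<Longrightarrow> \<sigma> ` {0..T} \<inter> C \<noteq> {}"
      unfolding P_def by metis
    \<comment> \<open>The points of \<open>X\<close> whose whole fibre lies in \<open>V\<close>;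
      written as the complement of an image, it is visibly open for a closed map.\<close>
    define push where "push V = topspace X - \<Psi> ` (topspace X0 - V)" for V
    have push_open: "openin X (push V)" if "openin X0 V" for V
    proof -
      have "closedin X0 (topspace X0 - V)" using that by blast
      then have "closedin X (\<Psi> ` (topspace X0 - V))" using closed_\<Psi> by (simp add: closed_map_def)
      then show ?thesis unfolding push_def by blast
    qed
    have push_mem: "x \<in> push V" if "x \<in> topspace X" "fib x \<subseteq> V" for x V
      using that by (auto simp: push_def fib_def)
    have pull: "Pt (G z) \<in> V" if "z \<in> \<Omega>" "Pt z \<in> push V" for z V
    proof (rule ccontr)
      assume "Pt (G z) \<notin> V"
      moreover have Gz: "G z \<in> \<Omega>\<^sub>0" using imG that by auto
      then have "Pt (G z) \<in> topspace X0" using closure_subset[of \<Omega>\<^sub>0] by (auto simp: X0_def)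
      ultimately have "\<Psi> (Pt (G z)) \<in> \<Psi> ` (topspace X0 - V)" by simp
      then show False using that ext[OF Gz] inv by (simp add: push_def)
    qed
    \<comment> \<open>\<open>P\<close> carries no information on closures, so their disjointness is
      arranged in \<open>X\<close> itself and kept under intersection with the pushed sets.\<close>
    obtain V1 W1 where VW1: "openin X V1" "openin X W1" "\<zeta> \<in> V1" "\<eta> \<in> W1"
      and disj: "X closure_of V1 \<inter> X closure_of W1 = {}"
      by (rule compact_Hausdorff_disjoint_closures[OF X \<zeta>X \<eta>X \<open>\<zeta> \<noteq> \<eta>\<close>])
    define V where "V = V1 \<inter> push V0"
    define W where "W = W1 \<inter> push W0"
    show ?thesis
      unfolding visibility_property_def X_def[symmetric]
    proof (rule exI[of _ V], rule exI[of _ W], rule exI[of _ "\<Phi> ` C"], intro conjI allI impI, goal_cases)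
      case 1 show ?case unfolding V_def using VW1 VW0 push_open by auto
    next
      case 2 show ?case unfolding V_def using VW1 VW0 push_mem[OF \<zeta>X] by auto
    next
      case 3 show ?case unfolding W_def using VW1 VW0 push_open by auto
    next
      case 4 show ?case unfolding W_def using VW1 VW0 push_mem[OF \<eta>X] by auto
    next
      case 5
      have "X closure_of V \<subseteq> X closure_of V1" "X closure_of W \<subseteq> X closure_of W1"
        unfolding V_def W_def by (auto intro!: closure_of_mono)
      then show ?case using disj by auto
    next
      case 6
      show ?case
        using holomorphic_map_on_continuous_on[OF hol\<Phi>] C continuous_on_subset
        by (metis compact_continuous_image)
    next
      case 7 show ?case using im\<Phi> C(2) by auto
    next
      case (8 T \<sigma>)
      then have T: "0 \<le> T" and ag: "almost_geodesic \<Omega> l k {0..T} \<sigma>" and ends: "Pt (\<sigma> 0) \<in> V" "Pt (\<sigma> T) \<in> W"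
        by simp_all
      have \<sigma>\<Omega>: "\<sigma> t \<in> \<Omega>" if "t \<in> {0..T}" for t
        using ag that unfolding almost_geodesic_def by (metis imageI subsetD)
      have "(G \<circ> \<sigma>) ` {0..T} \<inter> C \<noteq> {}"
      proof (rule hit[OF T])
        show "almost_geodesic \<Omega>\<^sub>0 l k {0..T} (G \<circ> \<sigma>)"
          by (rule almost_geodesic_biholomorphic[OF \<open>open \<Omega>\<close> holG imG hol\<Phi> im\<Phi> inv ag])
        show "Pt ((G \<circ> \<sigma>) 0) \<in> V0"
          using pull[of "\<sigma> 0" V0] \<sigma>\<Omega>[of 0] T ends by (simp add: V_def)
        show "Pt ((G \<circ> \<sigma>) T) \<in> W0"
          using pull[of "\<sigma> T" W0] \<sigma>\<Omega>[of T] T ends by (simp add: W_def)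
      qed
      then obtain t where t: "t \<in> {0..T}" "G (\<sigma> t) \<in> C" by fastforce
      then have "\<sigma> t \<in> \<Phi> ` C" using inv[OF \<sigma>\<Omega>[OF t(1)]] by (metis imageI)
      then show ?case using t(1) by (metis IntI emptyE imageI)
    qed
  qed
  then show ?thesis using assms(1,2) by (simp add: visibility_domain_def)
qed



end
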